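(* Let $\nu>0$, $\tau>0$, let $N\ge 2$ be an integer, and let $u_0\in H^1(\mathbb T^2)\cap L^\infty(\mathbb T^2)$ have mean zero. Let $(u^n)_{n\ge 0}$ be generated by the stabilized semi-implicit Fourier-spectral scheme $$u^0=\Pi_N u_0,\qquad \frac{u^{n+1}-u^n}{\tau}=-\nu\Delta^2u^{n+1}+A\Delta(u^{n+1}-u^n)+\Delta\Pi_N\big(f(u^n)\big),\quad n\ge0,$$ with $f(u)=u^3-u$. Let $E_0=E(u_0)$. There exists a constant $\beta_c>0$ depending only on $E_0$ such that if $$A\ge \beta\cdot\big(\|u_0\|_\infty^2+\nu^{-1}|\log\nu|^2+1\big)\quad\text{for some }\beta\ge\beta_c,$$ then $E(u^{n+1})\le E(u^n)$ for all $n\ge0$ (for every $\tau>0$).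
   Context: $\mathbb T^2=\mathbb R^2/2\pi\mathbb Z^2$. For an integer $N\ge2$, $X_N=\operatorname{span}\{\cos(k\cdot x),\sin(k\cdot x): k\in\mathbb Z^2,|k|\le N\}$ and $\Pi_N:L^2(\mathbb T^2)\to X_N$ is the $L^2$-orthogonal projection (truncation of Fourier modes to $|k|\le N$). $F(u)=\frac14(u^2-1)^2$, $f=F'$, and the CH energy is $E(u)=\int_{\mathbb T^2}\big(\frac\nu2|\nabla u|^2+F(u)\big)\,dx$. The scheme determines $u^{n+1}$ uniquely via the Fourier multipliers $u^{n+1}=\frac{1-A\tau\Delta}{1+\nu\tau\Delta^2-A\tau\Delta}u^n+\frac{\tau\Delta\Pi_N}{1+\nu\tau\Delta^2-A\tau\Delta}f(u^n)$; all $u^n\in X_N$ have mean zero. *)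

theory Defs
  imports "HOL-Analysis.Analysis"
begin

text \<open>The torus T^2 = R^2/(2 pi Z^2) is modelled by 2 pi-periodic functions on real \<times> real,
  integrated over the fundamental box [0,2 pi]^2 with Lebesgue measure.\<close>

type_synonym pt = "real \<times> real"

definition box2 :: "pt set" where
  "box2 = {0..2*pi} \<times> {0..2*pi}"

definition periodic2 :: "(pt \<Rightarrow> real) \<Rightarrow> bool" where
  "periodic2 u \<longleftrightarrow> (\<forall>x y. u (x + 2*pi, y) = u (x, y) \<and> u (x, y + 2*pi) = u (x, y))"

definition dotk :: "int \<times> int \<Rightarrow> pt \<Rightarrow> real" where
  "dotk k x = real_of_int (fst k) * fst x + real_of_int (snd k) * snd x"

definition ksq :: "int \<times> int \<Rightarrow> real" where
  "ksq k = real_of_int (fst k ^ 2 + snd k ^ 2)"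

definition fcoef :: "(pt \<Rightarrow> real) \<Rightarrow> int \<times> int \<Rightarrow> complex" where
  "fcoef u k = complex_of_real (1 / (4 * pi^2)) *
     set_lebesgue_integral lebesgue box2
       (\<lambda>x. complex_of_real (u x) * exp (- \<i> * complex_of_real (dotk k x)))"

definition modes :: "nat \<Rightarrow> (int \<times> int) set" where
  "modes N = {k \<in> {- int N..int N} \<times> {- int N..int N}. ksq k \<le> real N ^ 2}"

definition trigpoly :: "nat \<Rightarrow> (int \<times> int \<Rightarrow> complex) \<Rightarrow> pt \<Rightarrow> real" where
  "trigpoly N c x = Re (\<Sum>k\<in>modes N. c k * exp (\<i> * complex_of_real (dotk k x)))"

definition PiN :: "nat \<Rightarrow> (pt \<Rightarrow> real) \<Rightarrow> pt \<Rightarrow> real" where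
  "PiN N u = trigpoly N (fcoef u)"

definition Fdw :: "real \<Rightarrow> real" where
  "Fdw s = (s^2 - 1)^2 / 4"

definition fdw :: "real \<Rightarrow> real" where
  "fdw s = s^3 - s"

text \<open>Dirichlet energy int |grad u|^2, via Parseval (H^1 seminorm on the torus).\<close>
definition dirichlet :: "(pt \<Rightarrow> real) \<Rightarrow> real" where
  "dirichlet u = 4 * pi^2 * (\<Sum>\<^sub>\<infinity>k. ksq k * (cmod (fcoef u k))^2)"

definition in_H1 :: "(pt \<Rightarrow> real) \<Rightarrow> bool" where
  "in_H1 u \<longleftrightarrow> (\<lambda>k. ksq k * (cmod (fcoef u k))^2) summable_on UNIV"

definition CH_energy :: "real \<Rightarrow> (pt \<Rightarrow> real) \<Rightarrow> real" where
  "CH_energy \<nu> u = \<nu> / 2 * dirichlet u + set_lebesgue_integral lebesgue box2 (\<lambda>x. Fdw (u x))"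

definition ess_bounded :: "(pt \<Rightarrow> real) \<Rightarrow> bool" where
  "ess_bounded u \<longleftrightarrow> (\<exists>C. AE x in lebesgue. x \<in> box2 \<longrightarrow> \<bar>u x\<bar> \<le> C)"

definition Linf_norm :: "(pt \<Rightarrow> real) \<Rightarrow> real" where
  "Linf_norm u = Inf {C. 0 \<le> C \<and> (AE x in lebesgue. x \<in> box2 \<longrightarrow> \<bar>u x\<bar> \<le> C)}"

text \<open>One step of the stabilized semi-implicit Fourier-spectral scheme, via its Fourier multipliers
  (Laplacian has symbol -|k|^2, bilaplacian |k|^4).\<close>
definition CH_step :: "real \<Rightarrow> real \<Rightarrow> real \<Rightarrow> nat \<Rightarrow> (pt \<Rightarrow> real) \<Rightarrow> pt \<Rightarrow> real" where
  "CH_step \<nu> \<tau> A N u = trigpoly N (\<lambda>k.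
     let d = 1 + \<nu> * \<tau> * ksq k ^ 2 + A * \<tau> * ksq k in
     complex_of_real ((1 + A * \<tau> * ksq k) / d) * fcoef u k
     + complex_of_real (- \<tau> * ksq k / d) * fcoef (\<lambda>x. fdw (u x)) k)"

fun CH_seq :: "real \<Rightarrow> real \<Rightarrow> real \<Rightarrow> nat \<Rightarrow> (pt \<Rightarrow> real) \<Rightarrow> nat \<Rightarrow> pt \<Rightarrow> real" where
  "CH_seq \<nu> \<tau> A N u0 0 = PiN N u0"
| "CH_seq \<nu> \<tau> A N u0 (Suc n) = CH_step \<nu> \<tau> A N (CH_seq \<nu> \<tau> A N u0 n)"

end

theory Submission
  imports Defs
begin

text \<open>
  Put \<open>G = A + \<surd>(\<nu>/\<tau>)\<close>. Testing the scheme against \<open>(-\<Delta>)\<^sup>-\<^sup>1 (u\<^sup>n\<^sup>+\<^sup>1 - u\<^sup>n)\<close> and expanding \<open>F\<close> to second order shows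
  that one step decreases the energy as soon as \<open>3/2 |u\<^sup>n|\<^sup>2\<close> and \<open>3/2 |u\<^sup>n\<^sup>+\<^sup>1|\<^sup>2\<close> are at most \<open>G\<close> everywhere. Hence
  everything reduces to sup bounds, propagated together with a bound \<open>K\<close> on the energy.

  Comparing \<open>\<Pi>\<^sub>N u\<^sub>0\<close> with a Fejer mean of \<open>u\<^sub>0\<close> gives \<open>|\<Pi>\<^sub>N u\<^sub>0|\<^sup>2 \<lesssim> \<parallel>u\<^sub>0\<parallel>\<^sub>\<infinity>\<^sup>2 + 1 + E\<^sub>0/\<nu>\<close> and
  \<open>E(\<Pi>\<^sub>N u\<^sub>0) \<lesssim> 1 + (\<nu>N)\<^sup>-\<^sup>2\<close>.

  If \<open>\<nu>N > 1\<close>, then \<open>K \<lesssim> 1\<close>. By Cauchy-Schwarz on the Fourier side, the multiplier of \<open>u\<^sup>n\<close> in the scheme, which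
  damps the frequencies above \<open>(G/\<nu>)\<^sup>1\<^sup>/\<^sup>2\<close>, contributes \<open>K/\<nu> (1 + ln (1 + G/\<nu>))\<close> to \<open>|u\<^sup>n\<^sup>+\<^sup>1|\<^sup>2\<close>, and the
  nonlinear term contributes \<open>K/\<nu>\<close>. Both are small compared to \<open>G\<close>, since \<open>A \<ge> \<beta> (|ln \<nu>|\<^sup>2/\<nu> + 1)\<close>.

  If \<open>\<nu>N \<le> 1\<close>, then \<open>K\<close> may be as large as \<open>(\<nu>N)\<^sup>-\<^sup>2\<close>, but the Nikolskii inequality on \<open>X\<^sub>N\<close> still yields
  \<open>|u\<^sup>n|\<^sup>2 \<lesssim> N \<parallel>u\<^sup>n\<parallel>\<^sub>4\<^sup>2 \<lesssim> N K\<^sup>1\<^sup>/\<^sup>2 \<lesssim> 1/\<nu>\<close>, and the increment \<open>u\<^sup>n\<^sup>+\<^sup>1 - u\<^sup>n\<close> is estimated similarly.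
\<close>

section \<open>Fourier analysis of trigonometric polynomials\<close>

lemma box2_eq_cbox: "box2 = cbox (0, 0) (2*pi, 2*pi)"
  by (auto simp: box2_def cbox_Pair_eq)

lemma compact_box2: "compact box2"
  by (simp add: box2_eq_cbox)

lemma box2_lebesgue [measurable]: "box2 \<in> sets lebesgue"
  by (simp add: box2_eq_cbox)

lemma measure_box2: "measure lebesgue box2 = 4 * pi^2"
proof -
  have "measure lebesgue box2 = measure lborel (cbox (0, 0) (2*pi, 2*pi) :: pt set)"
    by (simp add: box2_eq_cbox)
  also have "\<dots> = measure lborel (cbox 0 (2*pi)) * measure lborel (cbox 0 (2*pi))"
    by (subst content_Pair) simp
  finally show ?thesis by (simp add: power2_eq_square)
qed

lemma emeasure_box2_finite: "emeasure lebesgue box2 < \<infinity>"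
  by (simp add: box2_eq_cbox emeasure_lborel_cbox_eq)

lemma set_integrable_box2_continuous:
  fixes g :: "pt \<Rightarrow> 'b::euclidean_space"
  assumes "continuous_on UNIV g"
  shows "set_integrable lebesgue box2 g"
proof -
  have "set_integrable lborel box2 g"
    unfolding set_integrable_def
    by (rule borel_integrable_compact[OF compact_box2]) (rule continuous_on_subset[OF assms], simp)
  then show ?thesis
    unfolding set_integrable_def by (simp add: integrable_completion)
qed

definition ek :: "int \<times> int \<Rightarrow> pt \<Rightarrow> complex" where
  "ek k x = exp (\<i> * complex_of_real (dotk k x))"

lemma dotk_add: "dotk (j + k) x = dotk j x + dotk k x"
  and dotk_minus: "dotk (- k) x = - dotk k x"
  and dotk_zero [simp]: "dotk 0 x = 0"
  by (simp_all add: dotk_def algebra_simps)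

lemma ek_zero [simp]: "ek 0 x = 1"
  and ek_add: "ek (j + k) x = ek j x * ek k x"
  and ek_minus: "ek (- k) x = cnj (ek k x)"
  and norm_ek [simp]: "norm (ek k x) = 1"
  by (simp_all add: ek_def dotk_add dotk_minus exp_add[symmetric] algebra_simps exp_cnj)

lemma ek_diff: "ek (j - k) x = ek j x * cnj (ek k x)"
  using ek_add[of j "- k" x] by (simp add: ek_minus)

lemma continuous_ek: "continuous_on S (ek k)"
  unfolding ek_def dotk_def by (intro continuous_intros)

lemma fcoef_ek: "fcoef u k = complex_of_real (1 / (4 * pi^2)) *
     set_lebesgue_integral lebesgue box2 (\<lambda>x. complex_of_real (u x) * cnj (ek k x))"
  by (simp add: fcoef_def ek_def exp_cnj)

lemma integral_exp_int:
  fixes m :: int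
  shows "integral {0..2*pi} (\<lambda>t. exp (\<i> * complex_of_real (of_int m * t))) = (if m = 0 then 2 * pi else 0)"
proof (cases "m = 0")
  case True
  then show ?thesis by (simp add: scaleR_conv_of_real)
next
  case False
  have "((\<lambda>t. exp (\<i> * complex_of_real (of_int m * t))) has_integral
     (exp (\<i> * complex_of_real (of_int m * (2*pi))) / (\<i> * of_int m) - exp (\<i> * complex_of_real (of_int m * 0)) / (\<i> * of_int m))) {0..2*pi}"
  proof (rule fundamental_theorem_of_calculus)
    fix t :: real
    have "((\<lambda>z. exp (\<i> * of_int m * z) / (\<i> * of_int m)) has_field_derivative exp (\<i> * of_int m * of_real t)) (at (of_real t))"
      using False by (auto intro!: derivative_eq_intros)
    from has_vector_derivative_real_field[OF this]
    show "((\<lambda>t. exp (\<i> * complex_of_real (of_int m * t)) / (\<i> * of_int m)) has_vector_derivative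
        exp (\<i> * complex_of_real (of_int m * t))) (at t within {0..2*pi})"
      by (simp add: mult.assoc)
  qed simp
  moreover have "exp (\<i> * complex_of_real (of_int m * (2*pi))) = 1"
    using exp_integer_2pi[of "of_int m"] by (simp add: algebra_simps)
  ultimately have "((\<lambda>t. exp (\<i> * complex_of_real (of_int m * t))) has_integral 0) {0..2*pi}"
    by simp
  then show ?thesis using False by (simp add: integral_unique)
qed

text \<open>Fubini on the square factors the integral into two one-dimensional ones, and each of
  these vanishes by periodicity unless its frequency is zero.\<close>

lemma ek_orthogonal:
  "set_lebesgue_integral lebesgue box2 (ek k) = (if k = 0 then complex_of_real (4 * pi^2) else 0)"
proof -
  have "set_lebesgue_integral lebesgue box2 (ek k) = integral box2 (ek k)"
    by (rule set_lebesgue_integral_eq_integral(2)) (rule set_integrable_box2_continuous[OF continuous_ek])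
  also have "\<dots> = integral (cbox 0 (2*pi)) (\<lambda>x. integral (cbox 0 (2*pi)) (\<lambda>y. ek k (x, y)))"
    unfolding box2_eq_cbox by (rule integral_prod_continuous) (rule continuous_ek)
  also have "\<dots> = integral {0..2*pi} (\<lambda>x. integral {0..2*pi} (\<lambda>y.
      exp (\<i> * complex_of_real (of_int (fst k) * x)) * exp (\<i> * complex_of_real (of_int (snd k) * y))))"
    by (simp add: ek_def dotk_def exp_add[symmetric] algebra_simps)
  also have "\<dots> = integral {0..2*pi} (\<lambda>x. exp (\<i> * complex_of_real (of_int (fst k) * x))) *
      integral {0..2*pi} (\<lambda>y. exp (\<i> * complex_of_real (of_int (snd k) * y)))"
    by simp
  also have "\<dots> = (if k = 0 then complex_of_real (4 * pi^2) else 0)"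
    unfolding integral_exp_int by (auto simp: prod_eq_iff power2_eq_square)
  finally show ?thesis .
qed

lemma ek_orthogonal_diff:
  "set_lebesgue_integral lebesgue box2 (\<lambda>x. ek j x * cnj (ek k x)) = (if j = k then complex_of_real (4 * pi^2) else 0)"
  using ek_orthogonal[of "j - k"] unfolding ek_diff[abs_def] by auto

section \<open>Lattice modes and coefficient families of real functions\<close>

lemma ksq_nonneg [simp]: "0 \<le> ksq k" 
  and ksq_zero [simp]: "ksq 0 = 0"
  and ksq_minus [simp]: "ksq (- k) = ksq k"
  by (simp_all add: ksq_def)

lemma ksq_ge_1: "k \<noteq> 0 \<Longrightarrow> 1 \<le> ksq k"
proof -
  assume "k \<noteq> 0"
  then have "0 < fst k ^ 2 + snd k ^ 2"
    by (auto simp: prod_eq_iff sum_power2_gt_zero_iff)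
  then have "1 \<le> fst k ^ 2 + snd k ^ 2" by linarith
  then show ?thesis unfolding ksq_def by linarith
qed

lemma finite_modes [simp]: "finite (modes N)"
  by (simp add: modes_def)

lemma uminus_mode_iff [simp]: "- k \<in> modes N \<longleftrightarrow> k \<in> modes N"
  by (auto simp: modes_def mem_Times_iff)

lemma zero_mode [simp]: "0 \<in> modes N"
  by (simp add: modes_def mem_Times_iff)

lemma card_modes_le: "real (card (modes N)) \<le> (2 * real N + 1)^2"
proof -
  have "card (modes N) \<le> card ({- int N..int N} \<times> {- int N..int N})"
    by (rule card_mono) (auto simp: modes_def)
  also have "\<dots> = (2 * N + 1)^2"
    by (simp add: card_cartesian_product power2_eq_square nat_add_distrib nat_mult_distrib)
  finally have "real (card (modes N)) \<le> real ((2 * N + 1)^2)" by linarith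
  then show ?thesis by (simp add: add.commute)
qed

text \<open>The symmetry of the Fourier coefficients of a real-valued function. For such families
  the real part in \<open>trigpoly\<close> discards nothing.\<close>

definition herm :: "(int \<times> int \<Rightarrow> complex) \<Rightarrow> bool" where
  "herm c \<longleftrightarrow> (\<forall>k. c (- k) = cnj (c k))"

lemma herm_fcoef: "herm (fcoef u)"
proof -
  have "fcoef u (- k) = cnj (fcoef u k)" for k
  proof -
    have "set_lebesgue_integral lebesgue box2 (\<lambda>x. complex_of_real (u x) * ek k x)
        = cnj (set_lebesgue_integral lebesgue box2 (\<lambda>x. complex_of_real (u x) * cnj (ek k x)))"
      unfolding set_lebesgue_integral_def by (subst Bochner_Integration.integral_cnj[symmetric]) simp
    then show ?thesis by (simp add: fcoef_ek ek_minus)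
  qed
  then show ?thesis by (simp add: herm_def)
qed

text \<open>Conjugation permutes the summands, since \<open>modes N\<close> is symmetric under
  negation; the sum is therefore real.\<close>

lemma trigpoly_complex:
  assumes "herm c"
  shows "complex_of_real (trigpoly N c x) = (\<Sum>k\<in>modes N. c k * ek k x)"
proof -
  have "cnj (\<Sum>k\<in>modes N. c k * ek k x) = (\<Sum>k\<in>modes N. c (- k) * ek (- k) x)"
    using assms by (simp add: herm_def ek_minus del: split_paired_All)
  also have "\<dots> = (\<Sum>k\<in>modes N. c k * ek k x)"
    by (rule sum.reindex_bij_witness[of _ uminus uminus]) auto
  finally have "(\<Sum>k\<in>modes N. c k * ek k x) \<in> \<real>"
    by (simp add: Reals_cnj_iff)
  then show ?thesis
    unfolding trigpoly_def ek_def by (rule of_real_Re)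
qed

lemma continuous_trigpoly: "continuous_on S (trigpoly N c)"
  unfolding trigpoly_def dotk_def by (intro continuous_intros)

lemma abs_trigpoly_le: "\<bar>trigpoly N c x\<bar> \<le> (\<Sum>k\<in>modes N. cmod (c k))"
proof -
  have "\<bar>trigpoly N c x\<bar> \<le> cmod (\<Sum>k\<in>modes N. c k * ek k x)"
    unfolding trigpoly_def ek_def[symmetric] by (rule abs_Re_le_cmod)
  also have "\<dots> \<le> (\<Sum>k\<in>modes N. cmod (c k * ek k x))" by (rule norm_sum)
  finally show ?thesis by (simp add: norm_mult)
qed

lemma trigpoly_add: "trigpoly N (\<lambda>k. a k + b k) x = trigpoly N a x + trigpoly N b x"
  and trigpoly_diff: "trigpoly N (\<lambda>k. a k - b k) x = trigpoly N a x - trigpoly N b x"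
  by (simp_all add: trigpoly_def algebra_simps sum.distrib sum_subtractf)

lemma set_integrable_mult_cnj_ek:
  assumes "set_integrable lebesgue box2 (h :: pt \<Rightarrow> real)"
  shows "set_integrable lebesgue box2 (\<lambda>x. complex_of_real (h x) * ek k x)"
    and "set_integrable lebesgue box2 (\<lambda>x. complex_of_real (h x) * cnj (ek k x))"
proof -
  have "set_integrable lebesgue box2 (\<lambda>x. complex_of_real (h x) * ek k x)" for k
    unfolding set_integrable_def
  proof (rule Bochner_Integration.integrable_bound)
    show "integrable lebesgue (\<lambda>x. indicat_real box2 x *\<^sub>R h x)"
      using assms by (simp add: set_integrable_def)
    then have "(\<lambda>x. indicat_real box2 x *\<^sub>R h x) \<in> borel_measurable lebesgue" by simp
    moreover have "ek k \<in> borel_measurable lebesgue"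
      by (intro measurable_completion) (simp add: borel_measurable_continuous_onI[OF continuous_ek])
    ultimately have "(\<lambda>x. complex_of_real (indicat_real box2 x *\<^sub>R h x) * ek k x) \<in> borel_measurable lebesgue"
      by measurable
    then show "(\<lambda>x. indicat_real box2 x *\<^sub>R (complex_of_real (h x) * ek k x)) \<in> borel_measurable lebesgue"
      by (simp add: scaleR_conv_of_real mult.assoc)
  qed (simp add: norm_mult)
  from this[of k] this[of "- k"]
  show "set_integrable lebesgue box2 (\<lambda>x. complex_of_real (h x) * ek k x)"
    and "set_integrable lebesgue box2 (\<lambda>x. complex_of_real (h x) * cnj (ek k x))"
    by (simp_all add: ek_minus)
qed

lemma set_integral_complex_of_real:
  "set_lebesgue_integral lebesgue box2 (\<lambda>x. complex_of_real (h x)) = complex_of_real (set_lebesgue_integral lebesgue box2 h)"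
  unfolding set_lebesgue_integral_def by (simp add: scaleR_conv_of_real flip: of_real_mult)

lemma fcoef_zero: "fcoef u 0 = complex_of_real (set_lebesgue_integral lebesgue box2 u / (4 * pi^2))"
  by (simp add: fcoef_ek set_integral_complex_of_real)

lemma set_integral_sum:
  fixes f :: "'i \<Rightarrow> pt \<Rightarrow> complex"
  assumes "finite I" "\<And>i. i \<in> I \<Longrightarrow> set_integrable lebesgue box2 (f i)"
  shows "set_lebesgue_integral lebesgue box2 (\<lambda>x. \<Sum>i\<in>I. f i x) = (\<Sum>i\<in>I. set_lebesgue_integral lebesgue box2 (f i))"
  using assms unfolding set_lebesgue_integral_def set_integrable_def
  by (simp add: scaleR_sum_right Bochner_Integration.integral_sum del: sum_indicator_scaleR)

text \<open>A real trigonometric polynomial equals its own conjugate, and the conjugated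
  exponentials integrated against h are the Fourier coefficients of h.\<close>

lemma parseval_trigpoly:
  assumes h: "set_integrable lebesgue box2 (h :: pt \<Rightarrow> real)" and c: "herm c"
  shows "set_lebesgue_integral lebesgue box2 (\<lambda>x. h x * trigpoly N c x)
    = 4 * pi^2 * (\<Sum>k\<in>modes N. Re (fcoef h k * cnj (c k)))"
proof -
  have eq: "complex_of_real (h x * trigpoly N c x) = (\<Sum>k\<in>modes N. cnj (c k) * (complex_of_real (h x) * cnj (ek k x)))" for x
  proof -
    have "complex_of_real (trigpoly N c x) = cnj (complex_of_real (trigpoly N c x))" by simp
    also have "\<dots> = (\<Sum>k\<in>modes N. cnj (c k) * cnj (ek k x))"
      by (subst trigpoly_complex[OF c]) simp
    finally show ?thesis
      by (simp add: sum_distrib_left mult_ac)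
  qed
  have "complex_of_real (set_lebesgue_integral lebesgue box2 (\<lambda>x. h x * trigpoly N c x))
      = set_lebesgue_integral lebesgue box2 (\<lambda>x. \<Sum>k\<in>modes N. cnj (c k) * (complex_of_real (h x) * cnj (ek k x)))"
    by (simp only: set_integral_complex_of_real[symmetric] eq)
  also have "\<dots> = (\<Sum>k\<in>modes N. cnj (c k) * set_lebesgue_integral lebesgue box2 (\<lambda>x. complex_of_real (h x) * cnj (ek k x)))"
    by (subst set_integral_sum) (auto intro!: set_integrable_mult_right set_integrable_mult_cnj_ek h)
  also have "\<dots> = (\<Sum>k\<in>modes N. complex_of_real (4 * pi^2) * (fcoef h k * cnj (c k)))"
    by (rule sum.cong) (auto simp: fcoef_ek)
  also have "\<dots> = complex_of_real (4 * pi^2) * (\<Sum>k\<in>modes N. fcoef h k * cnj (c k))"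
    by (simp add: sum_distrib_left)
  finally have "Re (complex_of_real (set_lebesgue_integral lebesgue box2 (\<lambda>x. h x * trigpoly N c x)))
      = Re (complex_of_real (4 * pi^2) * (\<Sum>k\<in>modes N. fcoef h k * cnj (c k)))" by (rule arg_cong)
  then show ?thesis by simp
qed

text \<open>The frequencies \<phi> p may coincide. This covers products of trigonometric
  polynomials, where several pairs of modes have the same sum.\<close>

lemma fcoef_exponential_sum:
  assumes P: "finite P" and h: "\<And>x. complex_of_real (h x) = (\<Sum>p\<in>P. a p * ek (\<phi> p) x)"
  shows "fcoef h m = (\<Sum>p\<in>P. if \<phi> p = m then a p else 0)"
proof -
  have "set_lebesgue_integral lebesgue box2 (\<lambda>x. complex_of_real (h x) * cnj (ek m x))
      = set_lebesgue_integral lebesgue box2 (\<lambda>x. \<Sum>p\<in>P. a p * (ek (\<phi> p) x * cnj (ek m x)))"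
    by (simp add: h sum_distrib_right mult.assoc)
  also have "\<dots> = (\<Sum>p\<in>P. a p * set_lebesgue_integral lebesgue box2 (\<lambda>x. ek (\<phi> p) x * cnj (ek m x)))"
    using P by (subst set_integral_sum)
      (auto intro!: set_integrable_mult_right set_integrable_box2_continuous continuous_intros continuous_ek)
  also have "\<dots> = complex_of_real (4 * pi^2) * (\<Sum>p\<in>P. if \<phi> p = m then a p else 0)"
    unfolding ek_orthogonal_diff by (auto simp: sum_distrib_left intro!: sum.cong)
  finally show ?thesis by (simp add: fcoef_ek)
qed

lemma fcoef_trigpoly:
  assumes "herm c"
  shows "fcoef (trigpoly N c) k = (if k \<in> modes N then c k else 0)"
  using fcoef_exponential_sum[of "modes N" "trigpoly N c" c id k] trigpoly_complex[OF assms] by simp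

lemma dirichlet_trigpoly:
  assumes "herm c"
  shows "dirichlet (trigpoly N c) = 4 * pi^2 * (\<Sum>k\<in>modes N. ksq k * (cmod (c k))^2)"
proof -
  have "(\<Sum>\<^sub>\<infinity>k. ksq k * (cmod (fcoef (trigpoly N c) k))^2) = (\<Sum>\<^sub>\<infinity>k\<in>modes N. ksq k * (cmod (c k))^2)"
    by (rule infsum_cong_neutral) (auto simp: fcoef_trigpoly[OF assms])
  then show ?thesis by (simp add: dirichlet_def)
qed

lemma integral_trigpoly_sq:
  assumes "herm c"
  shows "set_lebesgue_integral lebesgue box2 (\<lambda>x. (trigpoly N c x)^2) = 4 * pi^2 * (\<Sum>k\<in>modes N. (cmod (c k))^2)"
proof -
  have "set_lebesgue_integral lebesgue box2 (\<lambda>x. trigpoly N c x * trigpoly N c x) =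
     4 * pi^2 * (\<Sum>k\<in>modes N. Re (fcoef (trigpoly N c) k * cnj (c k)))"
    by (rule parseval_trigpoly[OF set_integrable_box2_continuous[OF continuous_trigpoly] assms])
  then show ?thesis
    by (simp add: power2_eq_square fcoef_trigpoly[OF assms] cmod_def)
qed

text \<open>Expand the nonnegative integral of the squared difference between h and its truncation;
  the cross term is twice the integral of the squared truncation.\<close>

lemma bessel_modes:
  assumes h: "continuous_on UNIV (h :: pt \<Rightarrow> real)"
  shows "4 * pi^2 * (\<Sum>k\<in>modes N. (cmod (fcoef h k))^2) \<le> set_lebesgue_integral lebesgue box2 (\<lambda>x. (h x)^2)"
proof -
  let ?I = "set_lebesgue_integral lebesgue box2"
  let ?p = "trigpoly N (fcoef h)"
  note int = set_integrable_box2_continuous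
  have "0 \<le> ?I (\<lambda>x. (h x - ?p x)^2)"
    unfolding set_lebesgue_integral_def by (intro integral_nonneg_AE) auto
  also have "(\<lambda>x. (h x - ?p x)^2) = (\<lambda>x. (h x)^2 - 2 * (h x * ?p x) + (?p x)^2)"
    by (auto simp: power2_eq_square algebra_simps)
  also have "?I \<dots> = ?I (\<lambda>x. (h x)^2) - 2 * ?I (\<lambda>x. h x * ?p x) + ?I (\<lambda>x. (?p x)^2)"
    by (subst set_integral_add | subst set_integral_diff | 
        intro int continuous_intros continuous_trigpoly h | simp)+
  also have "\<dots> = ?I (\<lambda>x. (h x)^2) - 4 * pi^2 * (\<Sum>k\<in>modes N. (cmod (fcoef h k))^2)"
    unfolding integral_trigpoly_sq[OF herm_fcoef] parseval_trigpoly[OF int[OF h] herm_fcoef]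
    by (simp only: complex_norm_square[symmetric]) simp
  finally show ?thesis by simp
qed

section \<open>Energy decay of a step with bounded iterates\<close>

lemma sq_le_of_abs_le: "\<bar>y\<bar> \<le> z \<Longrightarrow> y^2 \<le> (z::real)^2"
  by (metis abs_ge_zero power2_abs power_mono)

lemma Fdw_nonneg [simp]: "0 \<le> Fdw s"
  by (simp add: Fdw_def)

text \<open>F is a quartic, so the second-order remainder is an exact multiple of (v - u)^2. Its
  quadratic part is at most u^2 + v^2 / 2, because 2uv \<le> u^2 + v^2.\<close>

lemma Fdw_taylor_le:
  assumes "\<bar>u\<bar> \<le> M" "\<bar>v\<bar> \<le> M"
  shows "Fdw v - Fdw u \<le> fdw u * (v - u) + (3 * M^2 / 2 - 1 / 2) * (v - u)^2"
proof -
  have sq: "u^2 \<le> M^2" "v^2 \<le> M^2"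
    using assms by (simp_all add: abs_le_square_iff[symmetric])
  have "2 * (u * v) \<le> u^2 + v^2"
    using sum_squares_bound[of u v] by simp
  then have le: "3/4 * u^2 + u * v / 2 + v^2 / 4 \<le> 3 * M^2 / 2"
    using sq by linarith
  have "Fdw v - Fdw u = fdw u * (v - u) + (3/4 * u^2 + u * v / 2 + v^2 / 4 - 1 / 2) * (v - u)^2"
    by (simp add: Fdw_def fdw_def power2_eq_square power3_eq_cube field_simps)
  also have "\<dots> \<le> fdw u * (v - u) + (3 * M^2 / 2 - 1 / 2) * (v - u)^2"
    using le by (intro add_left_mono mult_right_mono) auto
  finally show ?thesis .
qed

lemma continuous_Fdw: "continuous_on S u \<Longrightarrow> continuous_on S (\<lambda>x. Fdw (u x))"
  and continuous_fdw: "continuous_on S u \<Longrightarrow> continuous_on S (\<lambda>x. fdw (u x))"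
  unfolding Fdw_def fdw_def by (auto intro!: continuous_intros)

lemma set_integral_mono_continuous:
  fixes g h :: "pt \<Rightarrow> real"
  assumes "continuous_on UNIV g" "continuous_on UNIV h" "\<And>x. g x \<le> h x"
  shows "set_lebesgue_integral lebesgue box2 g \<le> set_lebesgue_integral lebesgue box2 h"
  using assms by (intro set_integral_mono set_integrable_box2_continuous) auto

lemma PiN_trigpoly: "herm c \<Longrightarrow> PiN N (trigpoly N c) = trigpoly N c"
proof -
  assume "herm c"
  then have "trigpoly N (fcoef (trigpoly N c)) x = trigpoly N c x" for x
    unfolding trigpoly_def[of _ _ x] by (simp only: fcoef_trigpoly cong: sum.cong) simp
  then show ?thesis by (auto simp: PiN_def)
qed

lemma PiN_idem: "PiN N (PiN N u) = PiN N u"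
  using PiN_trigpoly[OF herm_fcoef] by (simp add: PiN_def)

text \<open>\<open>PiN N u = u\<close> encodes membership in X_N: it exhibits u as the trigonometric
  polynomial of its own Fourier coefficients.\<close>

lemma continuous_PiN_fixed: "PiN N u = u \<Longrightarrow> continuous_on S u"
  by (metis PiN_def continuous_trigpoly)

lemma dirichlet_PiN_fixed:
  "PiN N u = u \<Longrightarrow> dirichlet u = 4 * pi^2 * (\<Sum>k\<in>modes N. ksq k * (cmod (fcoef u k))^2)"
  using dirichlet_trigpoly[OF herm_fcoef, of N u] by (simp add: PiN_def)

lemma dirichlet_nonneg: "0 \<le> dirichlet u"
  unfolding dirichlet_def by (intro mult_nonneg_nonneg infsum_nonneg) auto

lemma set_integral_nonneg_box2: "(\<And>x. 0 \<le> g x) \<Longrightarrow> 0 \<le> set_lebesgue_integral lebesgue box2 (g :: pt \<Rightarrow> real)"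
  unfolding set_lebesgue_integral_def by (intro integral_nonneg_AE) auto

lemma integral_Fdw_le_energy:
  "0 \<le> \<nu> \<Longrightarrow> set_lebesgue_integral lebesgue box2 (\<lambda>x. Fdw (u x)) \<le> CH_energy \<nu> u"
  using dirichlet_nonneg[of u] by (simp add: CH_energy_def)

lemma dirichlet_le_energy: "0 < \<nu> \<Longrightarrow> \<nu> * dirichlet u \<le> 2 * CH_energy \<nu> u"
  using set_integral_nonneg_box2[of "\<lambda>x. Fdw (u x)"] by (simp add: CH_energy_def)

lemma pi_sq_bounds: "9 < pi^2" "pi^2 < 10"
proof -
  show "9 < pi^2" using power_strict_mono[OF pi_gt3, of 2] by simp
  have "pi < 3.15" using pi_approx by simp
  from power_strict_mono[OF this, of 2] show "pi^2 < 10" by (simp add: power2_eq_square)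
qed

text \<open>The hypothesis \<open>D\<close> is an equality for elements of X_N and follows from
  \<open>in_H1\<close> for the initial datum, so both are served. Only 4 pi^2 \<ge> 2 is used of the
  constant.\<close>

lemma sum_ksq_fcoef_le_energy:
  assumes "0 < \<nu>" and D: "4 * pi^2 * (\<Sum>k\<in>modes N. ksq k * (cmod (fcoef u k))^2) \<le> dirichlet u"
  shows "(\<Sum>k\<in>modes N. ksq k * (cmod (fcoef u k))^2) \<le> CH_energy \<nu> u / \<nu>"
proof -
  let ?s = "\<Sum>k\<in>modes N. ksq k * (cmod (fcoef u k))^2"
  have "0 \<le> ?s" by (intro sum_nonneg) auto
  then have "2 * ?s \<le> 4 * pi^2 * ?s" using pi_sq_bounds by (intro mult_right_mono) auto
  with D have "2 * ?s \<le> dirichlet u" by linarith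
  then have "\<nu> * (2 * ?s) \<le> \<nu> * dirichlet u" using assms(1) by (intro mult_left_mono) auto
  with dirichlet_le_energy[OF assms(1), of u] have "\<nu> * ?s \<le> CH_energy \<nu> u" by linarith
  then show ?thesis using assms(1) by (simp add: pos_le_divide_eq mult.commute)
qed

text \<open>Uses \<open>f(s)\<^sup>2 = 4 s\<^sup>2 F(s)\<close>.\<close>

lemma sum_fcoef_fdw_le_energy:
  assumes "0 < \<nu>" "PiN N u = u" "\<And>x. (u x)^2 \<le> S"
  shows "(\<Sum>k\<in>modes N. (cmod (fcoef (\<lambda>x. fdw (u x)) k))^2) \<le> S * CH_energy \<nu> u"
proof -
  let ?s = "\<Sum>k\<in>modes N. (cmod (fcoef (\<lambda>x. fdw (u x)) k))^2"
  note c = continuous_PiN_fixed[OF assms(2)]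
  have S: "0 \<le> S" using assms(3)[of undefined] by (smt (verit) zero_le_power2)
  have "0 \<le> ?s" by (intro sum_nonneg) auto
  then have "4 * ?s \<le> 4 * pi^2 * ?s"
    using pi_sq_bounds by (intro mult_right_mono) auto
  also have "\<dots> \<le> set_lebesgue_integral lebesgue box2 (\<lambda>x. (fdw (u x))^2)"
    by (rule bessel_modes) (intro continuous_fdw c)
  also have "\<dots> \<le> set_lebesgue_integral lebesgue box2 (\<lambda>x. 4 * S * Fdw (u x))"
  proof (rule set_integral_mono_continuous)
    fix x
    have "(fdw (u x))^2 = (u x)^2 * (4 * Fdw (u x))"
      by (simp add: fdw_def Fdw_def power2_eq_square power3_eq_cube field_simps)
    also have "\<dots> \<le> S * (4 * Fdw (u x))" by (rule mult_right_mono[OF assms(3)]) simp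
    finally show "(fdw (u x))^2 \<le> 4 * S * Fdw (u x)" by simp
  qed (auto intro!: continuous_intros continuous_fdw continuous_Fdw c)
  also have "\<dots> = 4 * S * set_lebesgue_integral lebesgue box2 (\<lambda>x. Fdw (u x))" by simp
  also have "\<dots> \<le> 4 * S * CH_energy \<nu> u"
    using S assms(1) by (intro mult_left_mono integral_Fdw_le_energy) auto
  finally show ?thesis by simp
qed

section \<open>The scheme on the Fourier side and its energy balance\<close>

definition step_coef :: "real \<Rightarrow> real \<Rightarrow> real \<Rightarrow> (pt \<Rightarrow> real) \<Rightarrow> int \<times> int \<Rightarrow> complex" where
  "step_coef \<nu> \<tau> A u k =
     complex_of_real ((1 + A * \<tau> * ksq k) / (1 + \<nu> * \<tau> * ksq k ^ 2 + A * \<tau> * ksq k)) * fcoef u k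
     + complex_of_real (- \<tau> * ksq k / (1 + \<nu> * \<tau> * ksq k ^ 2 + A * \<tau> * ksq k)) * fcoef (\<lambda>x. fdw (u x)) k"

lemma CH_step_eq: "CH_step \<nu> \<tau> A N u = trigpoly N (step_coef \<nu> \<tau> A u)"
  unfolding CH_step_def step_coef_def[abs_def] Let_def by (rule refl)

lemma herm_step_coef: "herm (step_coef \<nu> \<tau> A u)"
  using herm_fcoef[of u] herm_fcoef[of "\<lambda>x. fdw (u x)"]
  by (simp add: herm_def step_coef_def del: split_paired_All)

lemma PiN_CH_step: "PiN N (CH_step \<nu> \<tau> A N u) = CH_step \<nu> \<tau> A N u"
  unfolding CH_step_eq by (rule PiN_trigpoly[OF herm_step_coef])

lemma PiN_CH_seq: "PiN N (CH_seq \<nu> \<tau> A N u n) = CH_seq \<nu> \<tau> A N u n"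
  by (cases n) (simp_all add: PiN_idem PiN_CH_step)

lemma step_coef_zero: "step_coef \<nu> \<tau> A u 0 = fcoef u 0"
  by (simp add: step_coef_def)

text \<open>At k = 0 the multiplier of the iterate is 1 and that of the nonlinearity is 0, so the
  mean is conserved.\<close>

lemma fcoef_CH_seq_zero:
  assumes "set_lebesgue_integral lebesgue box2 u = 0"
  shows "fcoef (CH_seq \<nu> \<tau> A N u n) 0 = 0"
proof (induction n)
  case 0
  have "fcoef (PiN N u) 0 = fcoef u 0"
    by (simp only: PiN_def fcoef_trigpoly[OF herm_fcoef] zero_mode if_True)
  then show ?case using assms by (simp add: fcoef_zero[of u])
next
  case (Suc n)
  then show ?case by (simp add: CH_step_eq fcoef_trigpoly[OF herm_step_coef] step_coef_zero)
qed

text \<open>The scheme tested against \<open>(-\<Delta>)\<^sup>-\<^sup>1 (u\<^sup>n\<^sup>+\<^sup>1 - u\<^sup>n)\<close>, mode by mode, with \<open>q = |k|\<^sup>2\<close>.\<close>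

lemma mode_energy_identity:
  fixes a b f :: complex and \<nu> \<tau> A q :: real
  assumes "0 < \<tau>" "0 < q" "0 \<le> A" "0 < \<nu>"
    and b: "b = complex_of_real ((1 + A * \<tau> * q) / (1 + \<nu> * \<tau> * q ^ 2 + A * \<tau> * q)) * a
     + complex_of_real (- \<tau> * q / (1 + \<nu> * \<tau> * q ^ 2 + A * \<tau> * q)) * f"
  shows "\<nu> / 2 * (q * ((cmod b)^2 - (cmod a)^2)) + Re (f * cnj (b - a))
      = - (1 / (\<tau> * q) + \<nu> * q / 2 + A) * (cmod (b - a))^2"
proof -
  define d where "d = 1 + \<nu> * \<tau> * q ^ 2 + A * \<tau> * q"
  have "0 < d" using assms(1-4) unfolding d_def by (simp add: add_pos_nonneg)
  \<comment> \<open>The scheme solved for the nonlinear coefficient. It is stated over the reals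
    because the multipliers are real; it then applies to real and imaginary parts
    separately.\<close>
  have eq: "x = - ((y - z) * (1 / (\<tau> * q) + A) + \<nu> * q * y)"
    if "y = (1 + A * \<tau> * q) / d * z + (- \<tau> * q / d) * x" for x y z :: real
  proof -
    have "y = ((1 + A * \<tau> * q) * z - \<tau> * q * x) / d"
      by (simp add: that diff_divide_distrib)
    then have "d * y = (1 + A * \<tau> * q) * z - \<tau> * q * x"
      using \<open>0 < d\<close> by simp
    then have "\<tau> * q * x = - ((y - z) * (1 + A * \<tau> * q) + \<nu> * \<tau> * q^2 * y)"
      by (simp add: d_def algebra_simps)
    then have "x = - ((y - z) * (1 + A * \<tau> * q) + \<nu> * \<tau> * q^2 * y) / (\<tau> * q)"
      using assms(1,2) by (metis less_irrefl mult_pos_pos nonzero_mult_div_cancel_left)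
    then show ?thesis using assms(1,2) by (simp add: field_simps power2_eq_square)
  qed
  have re: "Re f = - ((Re b - Re a) * (1 / (\<tau> * q) + A) + \<nu> * q * Re b)"
    by (rule eq) (simp add: b d_def)
  have im: "Im f = - ((Im b - Im a) * (1 / (\<tau> * q) + A) + \<nu> * q * Im b)"
    by (rule eq) (simp add: b d_def)
  define r where "r = 1 / (\<tau> * q) + A"
  have "\<nu> / 2 * (q * ((cmod b)^2 - (cmod a)^2)) + Re (f * cnj (b - a)) = - (r + \<nu> * q / 2) * (cmod (b - a))^2"
    unfolding cmod_power2 complex_cnj_diff times_complex.sel minus_complex.sel complex_cnj re im r_def[symmetric]
    by (simp add: power2_eq_square field_simps)
  then show ?thesis by (simp add: r_def algebra_simps)
qed

text \<open>The inequality of arithmetic and geometric means. It turns the time difference and the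
  bilaplacian into a stabilization that is uniform in the frequency and adds to A.\<close>

lemma sqrt_ratio_le:
  fixes \<nu> \<tau> q :: real
  assumes "0 < \<nu>" "0 < \<tau>" "0 < q"
  shows "sqrt (\<nu> / \<tau>) \<le> 1 / (\<tau> * q) + \<nu> * q / 2"
proof (rule real_le_lsqrt)
  have arith_le: "4 * (x * y) \<le> (x + y)^2" for x y :: real
    using zero_le_power2[of "x - y"] by (simp add: power2_eq_square algebra_simps)
  have "\<nu> / \<tau> \<le> 4 * ((1 / (\<tau> * q)) * (\<nu> * q / 2))" using assms by (simp add: field_simps)
  also have "\<dots> \<le> (1 / (\<tau> * q) + \<nu> * q / 2)^2"
    using arith_le .
  finally show "\<nu> / \<tau> \<le> (1 / (\<tau> * q) + \<nu> * q / 2)^2" .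
qed (use assms in auto)

text \<open>In each mode the dissipation coefficient 1 / (\<tau> q) + \<nu> q / 2 + A dominates the
  constant c of the Taylor remainder of F, by \<open>sqrt_ratio_le\<close>.\<close>

lemma CH_step_energy_le:
  assumes pos: "0 < \<nu>" "0 < \<tau>" "0 \<le> A" and u: "PiN N u = u"
    and M: "\<And>x. \<bar>u x\<bar> \<le> M" "\<And>x. \<bar>CH_step \<nu> \<tau> A N u x\<bar> \<le> M"
    and G: "3 * M^2 / 2 \<le> A + sqrt (\<nu> / \<tau>)"
  shows "CH_energy \<nu> (CH_step \<nu> \<tau> A N u) \<le> CH_energy \<nu> u"
proof -
  let ?I = "set_lebesgue_integral lebesgue box2"
  define a b f where "a = fcoef u" and "b = step_coef \<nu> \<tau> A u" and "f = fcoef (\<lambda>x. fdw (u x))"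
  define v where "v = CH_step \<nu> \<tau> A N u"
  define c where "c = 3 * M^2 / 2 - 1 / 2"
  have v: "v = trigpoly N b" by (simp add: v_def b_def CH_step_eq)
  have ua: "u = trigpoly N a" using u by (simp add: a_def PiN_def)
  have ha: "herm a" and hb: "herm b" by (simp_all add: a_def b_def herm_fcoef herm_step_coef)
  have hw: "herm (\<lambda>k. b k - a k)" using ha hb by (simp add: herm_def del: split_paired_All)
  have w: "v x - u x = trigpoly N (\<lambda>k. b k - a k) x" for x
    by (simp add: v ua trigpoly_diff)
  have cu: "continuous_on UNIV u" and cv: "continuous_on UNIV v"
    by (simp_all add: v ua continuous_trigpoly)
  note int = set_integrable_box2_continuous
  note ci = continuous_intros continuous_Fdw continuous_fdw cu cv
  have "?I (\<lambda>x. Fdw (v x)) - ?I (\<lambda>x. Fdw (u x)) = ?I (\<lambda>x. Fdw (v x) - Fdw (u x))"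
    by (intro set_integral_diff(2)[symmetric] int ci)
  also have "\<dots> \<le> ?I (\<lambda>x. fdw (u x) * (v x - u x) + c * (v x - u x)^2)"
    by (rule set_integral_mono_continuous) (auto intro!: ci Fdw_taylor_le M M[folded v_def] simp: c_def)
  also have "\<dots> = ?I (\<lambda>x. fdw (u x) * (v x - u x)) + ?I (\<lambda>x. c * (v x - u x)^2)"
    by (intro set_integral_add(2) int ci)
  also have "\<dots> = ?I (\<lambda>x. fdw (u x) * (v x - u x)) + c * ?I (\<lambda>x. (v x - u x)^2)"
    by simp
  also have "\<dots> = 4 * pi^2 * (\<Sum>k\<in>modes N. Re (f k * cnj (b k - a k))) + c * (4 * pi^2 * (\<Sum>k\<in>modes N. (cmod (b k - a k))^2))"
    unfolding w f_def by (simp only: parseval_trigpoly[OF int[OF continuous_fdw[OF cu]] hw] integral_trigpoly_sq[OF hw])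
  finally have F: "?I (\<lambda>x. Fdw (v x)) - ?I (\<lambda>x. Fdw (u x)) \<le> \<dots>" .
  have mode_le: "\<nu> / 2 * (ksq k * ((cmod (b k))^2 - (cmod (a k))^2)) + Re (f k * cnj (b k - a k)) + c * (cmod (b k - a k))^2 \<le> 0" for k
  proof (cases "k = 0")
    case True
    then show ?thesis by (simp add: a_def b_def step_coef_zero)
  next
    case False
    then have q: "0 < ksq k" using ksq_ge_1[of k] by linarith
    have "\<nu> / 2 * (ksq k * ((cmod (b k))^2 - (cmod (a k))^2)) + Re (f k * cnj (b k - a k))
        = - (1 / (\<tau> * ksq k) + \<nu> * ksq k / 2 + A) * (cmod (b k - a k))^2"
      by (rule mode_energy_identity[OF pos(2) q pos(3,1)]) (simp add: b_def a_def f_def step_coef_def)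
    moreover have "(c - (1 / (\<tau> * ksq k) + \<nu> * ksq k / 2 + A)) * (cmod (b k - a k))^2 \<le> 0"
      using sqrt_ratio_le[OF pos(1,2) q] G by (intro mult_nonpos_nonneg) (auto simp: c_def)
    ultimately show ?thesis by (simp add: algebra_simps)
  qed
  have "CH_energy \<nu> v - CH_energy \<nu> u
    = \<nu> / 2 * (4 * pi^2 * (\<Sum>k\<in>modes N. ksq k * (cmod (b k))^2)) - \<nu> / 2 * (4 * pi^2 * (\<Sum>k\<in>modes N. ksq k * (cmod (a k))^2))
      + (?I (\<lambda>x. Fdw (v x)) - ?I (\<lambda>x. Fdw (u x)))"
    unfolding CH_energy_def by (simp add: v dirichlet_trigpoly[OF hb] dirichlet_PiN_fixed[OF u] a_def)
  also have "\<dots> \<le> \<nu> / 2 * (4 * pi^2 * (\<Sum>k\<in>modes N. ksq k * (cmod (b k))^2)) - \<nu> / 2 * (4 * pi^2 * (\<Sum>k\<in>modes N. ksq k * (cmod (a k))^2))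
      + (4 * pi^2 * (\<Sum>k\<in>modes N. Re (f k * cnj (b k - a k))) + c * (4 * pi^2 * (\<Sum>k\<in>modes N. (cmod (b k - a k))^2)))"
    using F by simp
  also have "\<dots> = 4 * pi^2 * (\<Sum>k\<in>modes N. \<nu> / 2 * (ksq k * ((cmod (b k))^2 - (cmod (a k))^2)) + Re (f k * cnj (b k - a k)) + c * (cmod (b k - a k))^2)"
    by (simp only: sum.distrib sum_distrib_left[symmetric] right_diff_distrib sum_subtractf distrib_left) (simp add: algebra_simps)
  also have "\<dots> \<le> 0"
    by (intro mult_nonneg_nonpos sum_nonpos mode_le) auto
  finally show ?thesis by (simp add: v_def)
qed

section \<open>Sup bounds for one step\<close>

text \<open>The nonzero modes are grouped by maximum norm m. On such a shell |k|^2 \<ge> m^2, and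
  the shell is covered by four lattice segments of 2 m + 1 points each.\<close>

lemma sum_modes_le_sum_shells:
  fixes g :: "real \<Rightarrow> real"
  assumes anti: "\<And>s t. 0 < s \<Longrightarrow> s \<le> t \<Longrightarrow> g t \<le> g s" and nonneg: "\<And>t. 0 < t \<Longrightarrow> 0 \<le> g t"
  shows "(\<Sum>k\<in>modes N - {0}. g (ksq k)) \<le> 12 * (\<Sum>m=1..N. real m * g (real m ^ 2))"
proof -
  define r :: "int \<times> int \<Rightarrow> nat" where "r k = nat (max \<bar>fst k\<bar> \<bar>snd k\<bar>)" for k
  let ?R = "modes N - {0}"
  have r: "r ` ?R \<subseteq> {1..N}"
  proof (rule image_subsetI)
    fix k assume "k \<in> ?R"
    then have "\<bar>fst k\<bar> \<le> int N" "\<bar>snd k\<bar> \<le> int N" "fst k \<noteq> 0 \<or> snd k \<noteq> 0"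
      by (auto simp: modes_def zero_prod_def)
    then show "r k \<in> {1..N}" by (auto simp: r_def)
  qed
  have card: "card {k \<in> ?R. r k = m} \<le> 12 * m" if "m \<in> {1..N}" for m
  proof -
    let ?J = "{- int m..int m}"
    have "{k \<in> ?R. r k = m} \<subseteq> {int m, - int m} \<times> ?J \<union> ?J \<times> {int m, - int m}"
      by (auto simp: r_def max_def split: if_splits)
    then have "card {k \<in> ?R. r k = m} \<le> card ({int m, - int m} \<times> ?J \<union> ?J \<times> {int m, - int m})"
      by (intro card_mono) auto
    also have "\<dots> \<le> card ({int m, - int m} \<times> ?J) + card (?J \<times> {int m, - int m})"
      by (rule card_Un_le)
    also have "\<dots> \<le> 12 * m"
    proof -
      \<comment> \<open>The count 8 m + 4 is at most 12 m because m \<ge> 1.\<close>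
      have "card ?J = 2 * m + 1" by simp
      moreover have "card {int m, - int m} \<le> 2" by (simp add: card_insert_if)
      ultimately have "card ({int m, - int m} \<times> ?J) \<le> 2 * (2 * m + 1)" "card (?J \<times> {int m, - int m}) \<le> (2 * m + 1) * 2"
        unfolding card_cartesian_product by (simp_all only: mult_le_mono order_refl)
      then show ?thesis using that by simp
    qed
    finally show ?thesis .
  qed
  have "(\<Sum>k\<in>?R. g (ksq k)) = (\<Sum>m=1..N. \<Sum>k\<in>{k \<in> ?R. r k = m}. g (ksq k))"
    by (rule sum.group[symmetric]) (use r in auto)
  also have "\<dots> \<le> (\<Sum>m=1..N. \<Sum>k\<in>{k \<in> ?R. r k = m}. g (real m ^ 2))"
  proof (intro sum_mono anti)
    fix m k assume m: "m \<in> {1..N}" and k: "k \<in> {k \<in> ?R. r k = m}"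
    then show "0 < real m ^ 2" by simp
    have "real m = \<bar>real_of_int (fst k)\<bar> \<or> real m = \<bar>real_of_int (snd k)\<bar>"
      using k by (auto simp: r_def max_def)
    then have "real m ^ 2 = real_of_int (fst k) ^ 2 \<or> real m ^ 2 = real_of_int (snd k) ^ 2"
      by (metis power2_abs)
    then show "real m ^ 2 \<le> ksq k" by (auto simp: ksq_def)
  qed
  also have "\<dots> = (\<Sum>m=1..N. real (card {k \<in> ?R. r k = m}) * g (real m ^ 2))" by simp
  also have "\<dots> \<le> (\<Sum>m=1..N. real (12 * m) * g (real m ^ 2))"
    by (intro sum_mono mult_right_mono nonneg) (use card in \<open>auto simp del: of_nat_mult\<close>)
  also have "\<dots> = 12 * (\<Sum>m=1..N. real m * g (real m ^ 2))"
    by (simp add: sum_distrib_left mult.assoc)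
  finally show ?thesis .
qed

text \<open>Discrete version of \<open>\<integral> L / (t (t\<^sup>2 + L)) dt\<close>, by telescoping \<open>ln (1 + L / m\<^sup>2)\<close>.\<close>

lemma sum_log_le:
  fixes L :: real
  assumes "0 < L" "1 \<le> n"
  shows "(\<Sum>m=1..n. L / (real m * (real m ^ 2 + L))) \<le> 1 + ln (1 + L) - ln (1 + L / real n ^ 2)"
  using assms(2)
proof (induction n rule: dec_induct)
  \<comment> \<open>The single summand L / (1 + L) is below 1; this is the leading 1 of the
    bound.\<close>
  case base
  show ?case using assms(1) by simp
next
  case (step n)
  define m where "m = real n"
  have m: "1 \<le> m" using step by (simp add: m_def)
  \<comment> \<open>The ratio whose logarithm telescopes. The next summand is at most 1 - 1 / ?y,
    which is at most ln ?y.\<close>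
  let ?y = "(1 + L / m^2) / (1 + L / (m+1)^2)"
  have pos: "0 < 1 + L / m^2" "0 < 1 + L / (m+1)^2" using assms(1) m by (auto intro!: add_pos_nonneg)
  have "L / ((m+1) * ((m+1)^2 + L)) \<le> L * (2 * m + 1) / ((m+1)^2 * ((m+1)^2 + L))"
  proof -
    have "L / ((m+1) * ((m+1)^2 + L)) = L * (m + 1) / ((m+1)^2 * ((m+1)^2 + L))"
      using m by (simp add: power2_eq_square)
    also have "\<dots> \<le> L * (2 * m + 1) / ((m+1)^2 * ((m+1)^2 + L))"
      using m assms(1) by (intro divide_right_mono mult_left_mono) auto
    finally show ?thesis .
  qed
  also have "\<dots> \<le> L * (2 * m + 1) / ((m+1)^2 * (m^2 + L))"
    using m assms(1) by (intro divide_left_mono mult_left_mono add_right_mono power_mono mult_pos_pos add_pos_pos) auto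
  also have "\<dots> = 1 - 1 / ?y"
  proof -
    have "1 / ?y = (m^2 * ((m+1)^2 + L)) / ((m+1)^2 * (m^2 + L))"
    proof -
      have "1 + L / m^2 = (m^2 + L) / m^2" "1 + L / (m+1)^2 = ((m+1)^2 + L) / (m+1)^2"
        using m by (simp_all add: add_divide_distrib)
      then show ?thesis by simp
    qed
    moreover have "(m+1)^2 * (m^2 + L) \<noteq> 0" using m assms(1) by (auto simp: add_nonneg_eq_0_iff)
    then have "1 = ((m+1)^2 * (m^2 + L)) / ((m+1)^2 * (m^2 + L))" by (rule divide_self[symmetric])
    ultimately have "1 - 1 / ?y = ((m+1)^2 * (m^2 + L) - m^2 * ((m+1)^2 + L)) / ((m+1)^2 * (m^2 + L))"
      unfolding diff_divide_distrib by metis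
    also have "(m+1)^2 * (m^2 + L) - m^2 * ((m+1)^2 + L) = L * (2 * m + 1)"
      by (simp add: power2_eq_square algebra_simps)
    finally show ?thesis by (rule sym)
  qed
  also have "\<dots> \<le> ln ?y"
    using ln_le_minus_one[of "1 / ?y"] pos by (simp add: ln_div)
  also have "\<dots> = ln (1 + L / m^2) - ln (1 + L / (m+1)^2)"
    using pos by (simp add: ln_div)
  finally have "L / ((m+1) * ((m+1)^2 + L)) \<le> ln (1 + L / m^2) - ln (1 + L / (m+1)^2)" .
  with step.IH show ?case using step by (simp add: m_def add.commute)
qed

text \<open>Telescoping of 1 / (m^2 + L), a discrete counterpart of integrating t / (t^2 + L)^2. The
  factor lost is m + 1 \<le> 2 m + 1.\<close>

lemma sum_inverse_sq_le:
  fixes L :: real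
  assumes "0 < L"
  shows "(\<Sum>m=1..n. real m / (real m ^ 2 + L)^2) \<le> 1 / L - 1 / (real n ^ 2 + L)"
proof (induction n)
  case 0
  show ?case by simp
next
  case (Suc n)
  define m where "m = real n"
  have m: "0 \<le> m" by (simp add: m_def)
  have p: "0 < m^2 + L" "0 < (m+1)^2 + L" using assms by (auto intro!: add_nonneg_pos)
  have "(m+1) / ((m+1)^2 + L)^2 \<le> (2 * m + 1) / ((m+1)^2 + L)^2"
    using m by (intro divide_right_mono) auto
  also have "\<dots> \<le> (2 * m + 1) / ((m^2 + L) * ((m+1)^2 + L))"
    unfolding power2_eq_square[of "(m+1)^2 + L"] using m p
    by (intro divide_left_mono mult_right_mono add_right_mono power_mono mult_pos_pos) auto
  also have "\<dots> = 1 / (m^2 + L) - 1 / ((m+1)^2 + L)"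
    using p by (simp add: diff_frac_eq) (simp add: power2_eq_square algebra_simps)
  finally have "(m+1) / ((m+1)^2 + L)^2 \<le> 1 / (m^2 + L) - 1 / ((m+1)^2 + L)" .
  with Suc show ?case by (simp add: m_def add.commute)
qed

text \<open>The summand bounds the squared linear multiplier divided by |k|^2, up to a factor 2. In
  two dimensions the sum of 1 / |k|^2 diverges logarithmically, and the cutoff at |k|^2 of size L
  leaves ln (1 + L), uniformly in N.\<close>

lemma sum_modes_log_le:
  assumes "0 < L"
  shows "(\<Sum>k\<in>modes N - {0}. L / (ksq k * (ksq k + L))) \<le> 12 * (1 + ln (1 + L))"
proof -
  have "(\<Sum>k\<in>modes N - {0}. L / (ksq k * (ksq k + L))) \<le> 12 * (\<Sum>m=1..N. real m * (L / (real m ^ 2 * (real m ^ 2 + L))))"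
    by (rule sum_modes_le_sum_shells)
       (use assms in \<open>auto intro!: divide_left_mono mult_mono mult_pos_pos add_pos_pos divide_nonneg_nonneg mult_nonneg_nonneg\<close>)
  also have "(\<Sum>m=1..N. real m * (L / (real m ^ 2 * (real m ^ 2 + L)))) = (\<Sum>m=1..N. L / (real m * (real m ^ 2 + L)))"
    by (rule sum.cong) (auto simp: power2_eq_square)
  also have "\<dots> \<le> 1 + ln (1 + L)"
  proof (cases "N = 0")
    case True
    then show ?thesis using assms by simp
  next
    case False
    then have "0 \<le> ln (1 + L / real N ^ 2)" using assms by simp
    then show ?thesis using sum_log_le[OF assms, of N] False by simp
  qed
  finally show ?thesis by simp
qed

lemma sum_modes_inverse_sq_le:
  assumes "0 < L"
  shows "(\<Sum>k\<in>modes N - {0}. 1 / (ksq k + L)^2) \<le> 12 / L"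
proof -
  have "(\<Sum>k\<in>modes N - {0}. 1 / (ksq k + L)^2) \<le> 12 * (\<Sum>m=1..N. real m * (1 / (real m ^ 2 + L)^2))"
    by (rule sum_modes_le_sum_shells)
       (use assms in \<open>auto intro!: divide_left_mono power_mono mult_pos_pos\<close>)
  also have "(\<Sum>m=1..N. real m * (1 / (real m ^ 2 + L)^2)) \<le> 1 / L"
  proof -
    have "0 \<le> 1 / (real N ^ 2 + L)" using assms by simp
    then show ?thesis using sum_inverse_sq_le[OF assms, of N] by (simp del: zero_le_divide_1_iff)
  qed
  finally show ?thesis by simp
qed

text \<open>Cauchy-Schwarz against the constant 1, with at most (2 N + 1)^2 \<le> 9 N^2
  modes.\<close>

lemma sum_modes_sq_le:
  fixes y :: "int \<times> int \<Rightarrow> real"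
  assumes "1 \<le> N"
  shows "(\<Sum>k\<in>modes N. y k)^2 \<le> 9 * real N ^ 2 * (\<Sum>k\<in>modes N. (y k)^2)"
proof -
  have "(\<Sum>k\<in>modes N. y k)^2 \<le> (\<Sum>k\<in>modes N. (y k)^2) * real (card (modes N))"
    using sum_squared_le_sum_of_squares[of y "modes N"] by simp
  also have "\<dots> \<le> (\<Sum>k\<in>modes N. (y k)^2) * (9 * real N ^ 2)"
  proof (rule mult_left_mono)
    have "real (card (modes N)) \<le> (2 * real N + 1)^2" by (rule card_modes_le)
    also have "\<dots> \<le> (3 * real N)^2" using assms by (intro power_mono) auto
    finally show "real (card (modes N)) \<le> 9 * real N ^ 2" by (simp add: power_mult_distrib)
  qed (intro sum_nonneg, simp)
  finally show ?thesis by (simp add: mult.commute)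
qed

lemma sum_sq_le_2: "((x::real) + y)^2 \<le> 2 * (x^2 + y^2)"
  using zero_le_power2[of "x - y"] by (simp add: power2_eq_square algebra_simps)

section \<open>Increment and sup norm of one step\<close>

text \<open>The increment is - \<tau> q / d times \<nu> q a + f, where a and f are the coefficients
  of u and of its nonlinearity, and \<tau> q / d \<le> 1 / A whatever \<tau> is.\<close>

lemma step_coef_diff_le:
  assumes "0 < \<nu>" "0 < \<tau>" "0 < A"
  shows "cmod (step_coef \<nu> \<tau> A u k - fcoef u k) \<le> (\<nu> * ksq k * cmod (fcoef u k) + cmod (fcoef (\<lambda>x. fdw (u x)) k)) / A"
proof (cases "k = 0")
  case True
  then show ?thesis using assms by (simp add: step_coef_zero)
next
  case False
  then have q: "0 < ksq k" using ksq_ge_1[of k] by linarith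
  define d where "d = 1 + \<nu> * \<tau> * ksq k ^ 2 + A * \<tau> * ksq k"
  have d: "A * \<tau> * ksq k \<le> d" "0 < d" using assms q by (auto simp: d_def intro!: add_pos_nonneg)
  have le: "\<tau> * ksq k / d \<le> 1 / A"
    using d assms q by (simp add: field_simps)
  have "(1 + A * \<tau> * ksq k) / d = 1 - \<tau> * ksq k / d * (\<nu> * ksq k)"
    using d by (simp add: field_simps) (simp add: d_def power2_eq_square)
  then have m: "complex_of_real ((1 + A * \<tau> * ksq k) / d) = 1 - complex_of_real (\<tau> * ksq k / d) * complex_of_real (\<nu> * ksq k)"
    by (metis of_real_1 of_real_diff of_real_mult)
  have "step_coef \<nu> \<tau> A u k - fcoef u k
     = - complex_of_real (\<tau> * ksq k / d) * (complex_of_real (\<nu> * ksq k) * fcoef u k + fcoef (\<lambda>x. fdw (u x)) k)"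
    unfolding step_coef_def d_def[symmetric] m by (simp add: algebra_simps)
  then have "cmod (step_coef \<nu> \<tau> A u k - fcoef u k)
     = \<tau> * ksq k / d * cmod (complex_of_real (\<nu> * ksq k) * fcoef u k + fcoef (\<lambda>x. fdw (u x)) k)"
    using assms q d by (simp only: norm_mult norm_minus_cancel norm_of_real) simp
  also have "\<dots> \<le> 1 / A * (\<nu> * ksq k * cmod (fcoef u k) + cmod (fcoef (\<lambda>x. fdw (u x)) k))"
    using assms q by (intro mult_mono le norm_triangle_le) (auto simp: norm_mult)
  finally show ?thesis by simp
qed

text \<open>Cauchy-Schwarz over all modes costs powers of N. They are affordable when \<nu> N \<le>
  1, where the factor 1 / A^2 compensates them.\<close>

lemma CH_step_diff_sup_le:
  assumes pos: "0 < \<nu>" "0 < \<tau>" "0 < A" and N: "1 \<le> N" and u: "PiN N u = u"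
    and P: "(\<Sum>k\<in>modes N. ksq k * (cmod (fcoef u k))^2) \<le> P"
    and Q: "(\<Sum>k\<in>modes N. (cmod (fcoef (\<lambda>x. fdw (u x)) k))^2) \<le> Q"
  shows "(CH_step \<nu> \<tau> A N u x - u x)^2 \<le> 18 / A^2 * (\<nu>^2 * real N ^ 4 * P + real N ^ 2 * Q)"
proof -
  let ?a = "\<lambda>k. cmod (fcoef u k)" and ?f = "\<lambda>k. cmod (fcoef (\<lambda>x. fdw (u x)) k)"
  have "u x = trigpoly N (fcoef u) x" using u by (simp add: PiN_def)
  then have "CH_step \<nu> \<tau> A N u x - u x = trigpoly N (\<lambda>k. step_coef \<nu> \<tau> A u k - fcoef u k) x"
    by (simp add: CH_step_eq trigpoly_diff)
  also have "\<bar>\<dots>\<bar> \<le> (\<Sum>k\<in>modes N. cmod (step_coef \<nu> \<tau> A u k - fcoef u k))"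
    by (rule abs_trigpoly_le)
  also have "\<dots> \<le> (\<Sum>k\<in>modes N. (\<nu> * ksq k * ?a k + ?f k) / A)"
    by (intro sum_mono step_coef_diff_le pos)
  also have "\<dots> = (\<nu> * (\<Sum>k\<in>modes N. ksq k * ?a k) + (\<Sum>k\<in>modes N. ?f k)) / A"
    by (simp add: sum_divide_distrib[symmetric] sum.distrib sum_distrib_left mult.assoc)
  finally have "(CH_step \<nu> \<tau> A N u x - u x)^2 \<le> ((\<nu> * (\<Sum>k\<in>modes N. ksq k * ?a k) + (\<Sum>k\<in>modes N. ?f k)) / A)^2"
    by (rule sq_le_of_abs_le)
  also have "\<dots> \<le> 2 * ((\<nu> * (\<Sum>k\<in>modes N. ksq k * ?a k))^2 + (\<Sum>k\<in>modes N. ?f k)^2) / A^2"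
    unfolding power_divide by (intro divide_right_mono sum_sq_le_2) auto
  also have "\<dots> \<le> 2 * (\<nu>^2 * (9 * real N ^ 4 * P) + 9 * real N ^ 2 * Q) / A^2"
  proof (intro divide_right_mono mult_left_mono add_mono)
    have "(\<Sum>k\<in>modes N. ?f k)^2 \<le> 9 * real N ^ 2 * (\<Sum>k\<in>modes N. (?f k)^2)"
      by (rule sum_modes_sq_le[OF N])
    also have "\<dots> \<le> 9 * real N ^ 2 * Q" by (intro mult_left_mono Q) auto
    finally show "(\<Sum>k\<in>modes N. ?f k)^2 \<le> 9 * real N ^ 2 * Q" .
    have "(\<Sum>k\<in>modes N. ksq k * ?a k)^2 \<le> 9 * real N ^ 2 * (\<Sum>k\<in>modes N. (ksq k * ?a k)^2)"
      by (rule sum_modes_sq_le[OF N])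
    also have "\<dots> \<le> 9 * real N ^ 2 * (\<Sum>k\<in>modes N. real N ^ 2 * (ksq k * (?a k)^2))"
    proof (intro mult_left_mono sum_mono)
      fix k assume "k \<in> modes N"
      then have "ksq k * (ksq k * (?a k)^2) \<le> real N ^ 2 * (ksq k * (?a k)^2)"
        by (intro mult_right_mono) (auto simp: modes_def)
      then show "(ksq k * ?a k)^2 \<le> real N ^ 2 * (ksq k * (?a k)^2)"
        by (simp add: power2_eq_square mult_ac)
    qed auto
    also have "\<dots> \<le> 9 * real N ^ 2 * (real N ^ 2 * P)"
      unfolding sum_distrib_left[symmetric] by (intro mult_left_mono P) auto
    also have "\<dots> = 9 * real N ^ 4 * P" by (simp add: power4_eq_xxxx power2_eq_square)
    finally show "(\<nu> * (\<Sum>k\<in>modes N. ksq k * ?a k))^2 \<le> \<nu>^2 * (9 * real N ^ 4 * P)"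
      unfolding power_mult_distrib by (intro mult_left_mono) auto
  qed auto
  also have "\<dots> = 18 / A^2 * (\<nu>^2 * real N ^ 4 * P + real N ^ 2 * Q)"
    by (simp add: algebra_simps add_divide_distrib)
  finally show ?thesis .
qed

text \<open>With \<open>G = A + \<surd>(\<nu>/\<tau>)\<close> and \<open>L = G/\<nu>\<close>, both Fourier multipliers of the scheme are controlled
  uniformly in \<open>\<tau>\<close>, because \<open>1/\<tau> \<le> G\<^sup>2/\<nu>\<close> and \<open>1/\<tau> + \<nu>q\<^sup>2 \<ge> 2q\<surd>(\<nu>/\<tau>)\<close>.\<close>

lemma step_multiplier_le:
  fixes \<nu> \<tau> A q L :: real
  assumes pos: "0 < \<nu>" "0 < \<tau>" "0 < A" "0 < q" and L: "L = (A + sqrt (\<nu> / \<tau>)) / \<nu>"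
  defines "d \<equiv> 1 + \<nu> * \<tau> * q ^ 2 + A * \<tau> * q"
  shows "((1 + A * \<tau> * q) / d)^2 \<le> 2 * L / (q + L)"
    and "\<tau> * q / d \<le> 2 / (\<nu> * (q + L))"
proof -
  define s where "s = sqrt (\<nu> / \<tau>)"
  have s: "0 < s" and s2: "\<tau> * s^2 = \<nu>" using pos by (auto simp: s_def)
  have L': "\<nu> * L = A + s" and L0: "0 < L" using pos s by (auto simp: L s_def[symmetric])
  have d: "0 < d" using pos by (auto simp: d_def intro!: add_pos_nonneg)
  have n0: "0 < 1 + A * \<tau> * q" using pos by (auto intro!: add_pos_nonneg)
  have le1: "(1 + A * \<tau> * q) / d \<le> 1" using d pos by (simp add: d_def)
  have nonneg: "0 \<le> (1 + A * \<tau> * q) / d" using d pos by (intro divide_nonneg_nonneg add_nonneg_nonneg) auto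
  have "1 \<le> \<tau> * \<nu> * L^2"
  proof -
    have "s^2 \<le> (\<nu> * L)^2" unfolding L' using pos s by (intro power_mono) auto
    then have "\<tau> * s^2 \<le> \<tau> * (\<nu> * L)^2" using pos by simp
    then have "\<nu> * 1 \<le> \<nu> * (\<tau> * \<nu> * L^2)" unfolding s2 by (simp add: power2_eq_square mult_ac)
    then show ?thesis using pos by (simp only: mult_le_cancel_left_pos)
  qed
  moreover have "A * \<tau> * q \<le> \<tau> * \<nu> * (L * q)"
  proof -
    have "A * (\<tau> * q) \<le> (\<nu> * L) * (\<tau> * q)" unfolding L' using s pos by (intro mult_right_mono) auto
    then show ?thesis by (simp add: mult_ac)
  qed
  ultimately have p: "1 + A * \<tau> * q \<le> \<tau> * \<nu> * (L * (L + q))" (is "?p \<le> _")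
    by (simp add: algebra_simps power2_eq_square)
  \<comment> \<open>For q \<le> L it suffices that ?p \<le> d. For q > L, the bound \<open>p\<close>
    times q - L gives q^2 - L^2, which is matched with the term \<nu> \<tau> q^2 of d.\<close>
  have "?p * (q + L) \<le> 2 * L * d"
  proof (cases "q \<le> L")
    case True
    have "?p * (q + L) \<le> ?p * (2 * L)" using True n0 by (intro mult_left_mono) auto
    also have "\<dots> \<le> d * (2 * L)" using pos L0 by (intro mult_right_mono) (auto simp: d_def)
    finally show ?thesis by (simp add: mult_ac)
  next
    case False
    have "?p * (q - L) \<le> \<tau> * \<nu> * (L * (L + q)) * (q - L)"
      using False p by (intro mult_right_mono) auto
    also have "\<dots> = \<tau> * \<nu> * L * (q^2 - L^2)" by (simp add: algebra_simps power2_eq_square)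
    also have "\<dots> \<le> \<tau> * \<nu> * L * (2 * q^2)"
      using pos L0 by (intro mult_left_mono) (auto intro: order_trans[of _ 0])
    finally have "?p * (q - L) + ?p * (2 * L) \<le> \<tau> * \<nu> * L * (2 * q^2) + ?p * (2 * L)" by simp
    then show ?thesis by (simp add: d_def algebra_simps)
  qed
  then have "?p / d \<le> 2 * L / (q + L)" using d pos L0 by (simp add: field_simps)
  moreover have "(?p / d)^2 \<le> ?p / d" using mult_left_le[OF le1 nonneg] by (simp only: power2_eq_square)
  ultimately show "(?p / d)^2 \<le> 2 * L / (q + L)" by simp
  have "s * (2 * \<tau> * q) \<le> 1 + \<nu> * \<tau> * q^2"
  proof -
    have "(s * \<tau> * q)^2 = (\<tau> * s^2) * \<tau> * q^2" by (simp add: power2_eq_square)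
    then have "(s * \<tau> * q)^2 = \<nu> * \<tau> * q^2" by (simp only: s2)
    then show ?thesis using zero_le_power2[of "1 - s * \<tau> * q"] by (simp add: power2_diff)
  qed
  moreover have "0 \<le> \<nu> * \<tau> * q^2" "0 \<le> A * \<tau> * q" using pos by auto
  ultimately have "\<tau> * q * (\<nu> * q + (A + s)) \<le> 2 * d"
    by (simp add: d_def algebra_simps power2_eq_square)
  then have "\<tau> * q * (\<nu> * (q + L)) \<le> 2 * d" by (simp add: L'[symmetric] distrib_left)
  moreover have "0 < \<nu> * (q + L)" using pos L0 by simp
  ultimately have "\<tau> * q \<le> 2 * d / (\<nu> * (q + L))" by (simp only: pos_le_divide_eq)
  then show "\<tau> * q / d \<le> 2 / (\<nu> * (q + L))"
    using d by (simp only: pos_divide_le_eq times_divide_eq_left)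
qed

text \<open>A bound free of N: the linear part is paired with the gradient norm and produces the
  logarithmic lattice sum; the nonlinear part is paired with the L^2 norm and produces the
  convergent one. The zero mean removes k = 0, where division by |k| is impossible.\<close>

lemma CH_step_sup_le:
  assumes pos: "0 < \<nu>" "0 < \<tau>" "0 < A" and L: "L = (A + sqrt (\<nu> / \<tau>)) / \<nu>" and u0: "fcoef u 0 = 0"
    and P: "(\<Sum>k\<in>modes N. ksq k * (cmod (fcoef u k))^2) \<le> P"
    and Q: "(\<Sum>k\<in>modes N. (cmod (fcoef (\<lambda>x. fdw (u x)) k))^2) \<le> Q"
  shows "(CH_step \<nu> \<tau> A N u x)^2 \<le> 48 * (1 + ln (1 + L)) * P + 96 / (\<nu>^2 * L) * Q"
proof -
  let ?a = "\<lambda>k. cmod (fcoef u k)" and ?f = "\<lambda>k. cmod (fcoef (\<lambda>x. fdw (u x)) k)"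
  let ?R = "modes N - {0}"
  define d where "d k = 1 + \<nu> * \<tau> * ksq k ^ 2 + A * \<tau> * ksq k" for k
  define m where "m k = (1 + A * \<tau> * ksq k) / d k" for k
  have d: "0 < d k" for k using pos by (auto simp: d_def intro!: add_pos_nonneg)
  have m0: "0 \<le> m k" for k using d[of k] pos by (auto simp: m_def intro!: divide_nonneg_nonneg add_nonneg_nonneg)
  have q: "0 < ksq k" if "k \<in> ?R" for k using that ksq_ge_1[of k] by (auto simp del: split_paired_All)
  have "0 < sqrt (\<nu> / \<tau>)" using pos by simp
  then have L0: "0 < L" using pos by (auto simp: L intro!: divide_pos_pos add_pos_pos)
  have "\<bar>CH_step \<nu> \<tau> A N u x\<bar> \<le> (\<Sum>k\<in>modes N. cmod (step_coef \<nu> \<tau> A u k))"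
    unfolding CH_step_eq by (rule abs_trigpoly_le)
  also have "\<dots> = (\<Sum>k\<in>?R. cmod (step_coef \<nu> \<tau> A u k))"
    by (rule sum.mono_neutral_right) (auto simp: step_coef_zero u0)
  also have "\<dots> \<le> (\<Sum>k\<in>?R. m k * ?a k + 2 / (\<nu> * (ksq k + L)) * ?f k)"
  proof (rule sum_mono)
    fix k assume k: "k \<in> ?R"
    have "cmod (step_coef \<nu> \<tau> A u k) \<le> m k * ?a k + \<tau> * ksq k / d k * ?f k"
      unfolding step_coef_def d_def[symmetric] m_def[symmetric]
      using m0[of k] d[of k] pos q[OF k]
      by (intro norm_triangle_le add_mono) (simp_all only: norm_mult norm_of_real, auto)
    also have "\<dots> \<le> m k * ?a k + 2 / (\<nu> * (ksq k + L)) * ?f k"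
      using step_multiplier_le(2)[OF pos q[OF k] L] by (intro add_left_mono mult_right_mono) (auto simp: d_def)
    finally show "cmod (step_coef \<nu> \<tau> A u k) \<le> m k * ?a k + 2 / (\<nu> * (ksq k + L)) * ?f k" .
  qed
  also have "\<dots> = (\<Sum>k\<in>?R. m k * ?a k) + (\<Sum>k\<in>?R. 2 / (\<nu> * (ksq k + L)) * ?f k)"
    by (rule sum.distrib)
  finally have "(CH_step \<nu> \<tau> A N u x)^2 \<le> ((\<Sum>k\<in>?R. m k * ?a k) + (\<Sum>k\<in>?R. 2 / (\<nu> * (ksq k + L)) * ?f k))^2"
    by (rule sq_le_of_abs_le)
  also have "\<dots> \<le> 2 * ((\<Sum>k\<in>?R. m k * ?a k)^2 + (\<Sum>k\<in>?R. 2 / (\<nu> * (ksq k + L)) * ?f k)^2)"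
    by (rule sum_sq_le_2)
  also have "\<dots> \<le> 2 * (24 * (1 + ln (1 + L)) * P + 48 / (\<nu>^2 * L) * Q)"
  proof (intro mult_left_mono add_mono)
    \<comment> \<open>The weight |k| is moved from the multiplier to the coefficient before
      Cauchy-Schwarz, so that the gradient norm appears.\<close>
    have "(\<Sum>k\<in>?R. m k * ?a k)^2 = (\<Sum>k\<in>?R. (m k / sqrt (ksq k)) * (sqrt (ksq k) * ?a k))^2"
      by (intro arg_cong[where f = "\<lambda>t. t^2"] sum.cong refl) (use q in force)
    also have "\<dots> \<le> (\<Sum>k\<in>?R. (m k / sqrt (ksq k))^2) * (\<Sum>k\<in>?R. (sqrt (ksq k) * ?a k)^2)"
      by (rule Cauchy_Schwarz_ineq_sum)
    also have "\<dots> \<le> (24 * (1 + ln (1 + L))) * P"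
    proof (rule mult_mono)
      have "(\<Sum>k\<in>?R. (m k / sqrt (ksq k))^2) \<le> (\<Sum>k\<in>?R. 2 * (L / (ksq k * (ksq k + L))))"
      proof (rule sum_mono)
        fix k assume k: "k \<in> ?R"
        have "(m k / sqrt (ksq k))^2 = (m k)^2 / ksq k" by (simp add: power_divide)
        also have "\<dots> \<le> (2 * L / (ksq k + L)) / ksq k"
          using step_multiplier_le(1)[OF pos q[OF k] L] by (intro divide_right_mono) (auto simp: m_def d_def)
        finally show "(m k / sqrt (ksq k))^2 \<le> 2 * (L / (ksq k * (ksq k + L)))" by (simp add: mult.commute)
      qed
      also have "\<dots> \<le> 2 * (12 * (1 + ln (1 + L)))"
        unfolding sum_distrib_left[symmetric] by (intro mult_left_mono sum_modes_log_le L0) auto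
      finally show "(\<Sum>k\<in>?R. (m k / sqrt (ksq k))^2) \<le> 24 * (1 + ln (1 + L))" by simp
      have "(\<Sum>k\<in>?R. (sqrt (ksq k) * ?a k)^2) = (\<Sum>k\<in>?R. ksq k * (?a k)^2)" by (simp add: power_mult_distrib)
      also have "\<dots> \<le> (\<Sum>k\<in>modes N. ksq k * (?a k)^2)" by (intro sum_mono2) auto
      finally show "(\<Sum>k\<in>?R. (sqrt (ksq k) * ?a k)^2) \<le> P" using P by simp
    qed (use L0 in \<open>auto intro!: sum_nonneg\<close>)
    finally show "(\<Sum>k\<in>?R. m k * ?a k)^2 \<le> 24 * (1 + ln (1 + L)) * P" .
    have "(\<Sum>k\<in>?R. 2 / (\<nu> * (ksq k + L)) * ?f k)^2 \<le> (\<Sum>k\<in>?R. (2 / (\<nu> * (ksq k + L)))^2) * (\<Sum>k\<in>?R. (?f k)^2)"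
      by (rule Cauchy_Schwarz_ineq_sum)
    also have "\<dots> \<le> (48 / (\<nu>^2 * L)) * Q"
    proof (rule mult_mono)
      have "(\<Sum>k\<in>?R. (2 / (\<nu> * (ksq k + L)))^2) = 4 / \<nu>^2 * (\<Sum>k\<in>?R. 1 / (ksq k + L)^2)"
        by (simp add: sum_distrib_left power_divide power_mult_distrib)
      also have "\<dots> \<le> 4 / \<nu>^2 * (12 / L)" by (intro mult_left_mono sum_modes_inverse_sq_le L0) auto
      finally show "(\<Sum>k\<in>?R. (2 / (\<nu> * (ksq k + L)))^2) \<le> 48 / (\<nu>^2 * L)" by simp
      have "(\<Sum>k\<in>?R. (?f k)^2) \<le> (\<Sum>k\<in>modes N. (?f k)^2)" by (intro sum_mono2) auto
      then show "(\<Sum>k\<in>?R. (?f k)^2) \<le> Q" using Q by simp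
    qed (use L0 in \<open>auto intro!: sum_nonneg\<close>)
    finally show "(\<Sum>k\<in>?R. 2 / (\<nu> * (ksq k + L)) * ?f k)^2 \<le> 48 / (\<nu>^2 * L) * Q" .
  qed auto
  finally show ?thesis by (simp add: algebra_simps)
qed

section \<open>Nikolskii inequality and Fejer means\<close>

text \<open>Grouping the summands by frequency collects the Fourier coefficients. This re-expands a
  square of an element of X_N in distinct modes.\<close>

lemma exponential_sum_expansion:
  assumes P: "finite P" and B: "finite B" "\<phi> ` P \<subseteq> B"
    and h: "\<And>x. complex_of_real (h x) = (\<Sum>p\<in>P. a p * ek (\<phi> p) x)"
  shows "complex_of_real (h x) = (\<Sum>m\<in>B. fcoef h m * ek m x)"
proof -
  have "(\<Sum>m\<in>B. fcoef h m * ek m x) = (\<Sum>m\<in>B. \<Sum>p\<in>P. if \<phi> p = m then a p * ek m x else 0)"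
    unfolding fcoef_exponential_sum[OF P h] by (auto simp: sum_distrib_right intro!: sum.cong)
  also have "\<dots> = (\<Sum>p\<in>P. \<Sum>m\<in>B. if \<phi> p = m then a p * ek m x else 0)"
    by (rule sum.swap)
  also have "\<dots> = (\<Sum>p\<in>P. a p * ek (\<phi> p) x)"
    using B by (intro sum.cong) (auto simp: sum.delta')
  finally show ?thesis by (simp add: h)
qed

lemma mode_add: "k \<in> modes N \<Longrightarrow> l \<in> modes N \<Longrightarrow> k + l \<in> modes (2 * N)"
proof -
  assume k: "k \<in> modes N" and l: "l \<in> modes N"
  have "ksq (k + l) \<le> 2 * (ksq k + ksq l)"
    using sum_sq_le_2[of "real_of_int (fst k)" "real_of_int (fst l)"]
      sum_sq_le_2[of "real_of_int (snd k)" "real_of_int (snd l)"]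
    by (simp add: ksq_def)
  also have "\<dots> \<le> 2 * (real N ^ 2 + real N ^ 2)"
    using k l by (intro mult_left_mono add_mono) (auto simp: modes_def)
  finally have "ksq (k + l) \<le> real (2 * N) ^ 2" by (simp add: power2_eq_square)
  then show "k + l \<in> modes (2 * N)"
    using k l by (auto simp: modes_def mem_Times_iff)
qed

text \<open>The \<open>L\<^sup>4\<close>--\<open>L\<^sup>\<infinity>\<close> Nikolskii inequality on \<open>X\<^sub>N\<close> is the \<open>L\<^sup>2\<close>--\<open>L\<^sup>\<infinity>\<close> one applied to
  \<open>u\<^sup>2 \<in> X\<^sub>2\<^sub>N\<close>.\<close>

lemma nikolskii_4:
  assumes u: "PiN N u = u" and N: "1 \<le> N"
  shows "(u x)^4 \<le> real N ^ 2 * set_lebesgue_integral lebesgue box2 (\<lambda>x. (u x)^4)"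
proof -
  let ?h = "\<lambda>x. (u x)^2"
  define s where "s = (\<Sum>m\<in>modes (2 * N). (cmod (fcoef ?h m))^2)"
  have cu: "continuous_on UNIV u" by (rule continuous_PiN_fixed[OF u])
  have uc: "complex_of_real (u y) = (\<Sum>k\<in>modes N. fcoef u k * ek k y)" for y
    using trigpoly_complex[OF herm_fcoef, of N u y] u by (simp add: PiN_def)
  have prod: "complex_of_real (?h y) = (\<Sum>p\<in>modes N \<times> modes N. (fcoef u (fst p) * fcoef u (snd p)) * ek (fst p + snd p) y)" for y
    by (simp add: power2_eq_square uc sum_product sum.cartesian_product case_prod_unfold ek_add mult_ac)
  have "complex_of_real (?h x) = (\<Sum>m\<in>modes (2 * N). fcoef ?h m * ek m x)"
    by (rule exponential_sum_expansion[OF _ _ _ prod]) (auto simp del: split_paired_All add_Pair intro!: mode_add)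
  then have "\<bar>?h x\<bar> = cmod (\<Sum>m\<in>modes (2 * N). fcoef ?h m * ek m x)"
    by (metis norm_of_real)
  also have "\<dots> \<le> (\<Sum>m\<in>modes (2 * N). cmod (fcoef ?h m * ek m x))" by (rule norm_sum)
  also have "\<dots> = (\<Sum>m\<in>modes (2 * N). cmod (fcoef ?h m))" by (simp add: norm_mult)
  finally have "(?h x)^2 \<le> (\<Sum>m\<in>modes (2 * N). cmod (fcoef ?h m))^2" by (rule sq_le_of_abs_le)
  also have "\<dots> \<le> 9 * real (2 * N) ^ 2 * s"
    unfolding s_def using N by (intro sum_modes_sq_le) auto
  also have "\<dots> = real N ^ 2 * (36 * s)" by (simp add: power2_eq_square)
  also have "\<dots> \<le> real N ^ 2 * set_lebesgue_integral lebesgue box2 (\<lambda>x. (?h x)^2)"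
  proof (rule mult_left_mono)
    \<comment> \<open>The mode count for 2 N contributes 36 N^2. Since 36 \<le> 4 pi^2, the
      normalization of Parseval absorbs the constant.\<close>
    have "36 * s \<le> 4 * pi^2 * s"
      using pi_sq_bounds by (intro mult_right_mono) (auto simp: s_def intro!: sum_nonneg)
    also have "\<dots> \<le> set_lebesgue_integral lebesgue box2 (\<lambda>x. (?h x)^2)"
      unfolding s_def by (intro bessel_modes continuous_intros cu)
    finally show "36 * s \<le> set_lebesgue_integral lebesgue box2 (\<lambda>x. (?h x)^2)" .
  qed simp
  finally show ?thesis by (simp flip: power_mult)
qed

text \<open>The difference of the two sides is (s^2 - 2)^2. This converts the energy into control of
  the L^4 norm.\<close>

lemma pow4_le_Fdw: "(s::real)^4 \<le> 8 * Fdw s + 2"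
proof -
  have "0 \<le> (s^2 - 2)^2" by simp
  then show ?thesis by (simp add: Fdw_def power2_eq_square power4_eq_xxxx field_simps)
qed

lemma Fdw_le_pow4: "Fdw s \<le> (s^4 + 1) / 4"
  by (simp add: Fdw_def power2_eq_square power4_eq_xxxx algebra_simps)

lemma set_integrable_bounded:
  fixes u :: "pt \<Rightarrow> real"
  assumes "u \<in> borel_measurable lebesgue" "AE x in lebesgue. x \<in> box2 \<longrightarrow> \<bar>u x\<bar> \<le> C"
  shows "set_integrable lebesgue box2 u"
  unfolding set_integrable_def
proof (rule Bochner_Integration.integrable_bound)
  show "integrable lebesgue (\<lambda>x. indicat_real box2 x * C)"
    using emeasure_box2_finite by (intro integrable_mult_left integrable_real_indicator) auto
  show "(\<lambda>x. indicat_real box2 x *\<^sub>R u x) \<in> borel_measurable lebesgue"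
    using assms(1) by (intro borel_measurable_scaleR borel_measurable_indicator) auto
  show "AE x in lebesgue. norm (indicat_real box2 x *\<^sub>R u x) \<le> norm (indicat_real box2 x * C)"
    using assms(2) by eventually_elim (auto simp: indicator_def)
qed

lemma set_integral_const_box2: "set_lebesgue_integral lebesgue box2 (\<lambda>_. c :: real) = c * (4 * pi^2)"
  using measure_box2 by (simp add: set_lebesgue_integral_def mult.commute)

lemma fcoef_add:
  assumes "set_integrable lebesgue box2 f" "set_integrable lebesgue box2 g"
  shows "fcoef (\<lambda>x. f x + g x) k = fcoef f k + fcoef g k"
  unfolding fcoef_ek using assms
  by (simp add: distrib_right set_integral_add set_integrable_mult_cnj_ek distrib_left)

lemma fcoef_cmult: "fcoef (\<lambda>x. c * f x) k = complex_of_real c * fcoef f k"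
  unfolding fcoef_ek by (simp add: mult.assoc)

lemma fcoef_const: "fcoef (\<lambda>_. c) k = (if k = 0 then complex_of_real c else 0)"
  using fcoef_exponential_sum[of "{0::int \<times> int}" "\<lambda>_. c" "\<lambda>_. complex_of_real c" id k] by simp

section \<open>Fejer means\<close>

text \<open>The side N div 2 is chosen so that all differences of box points lie in
  \<open>modes N\<close>.\<close>

definition fejer_box :: "nat \<Rightarrow> (int \<times> int) set" where
  "fejer_box N = {0..int (N div 2)} \<times> {0..int (N div 2)}"

text \<open>The Fourier coefficients of the normalized squared modulus of the exponential sum over
  the box, kept as a count of pairs so that positivity of the kernel is immediate.\<close>

definition fejer_weight :: "nat \<Rightarrow> int \<times> int \<Rightarrow> real" where
  "fejer_weight N k = real (card {p \<in> fejer_box N \<times> fejer_box N. fst p - snd p = k}) / real (card (fejer_box N))"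

text \<open>The weights vanish outside \<open>modes N\<close>, so the truncation in
  \<open>trigpoly\<close> cuts nothing off and this is a full convolution.\<close>

definition fejer :: "nat \<Rightarrow> (pt \<Rightarrow> real) \<Rightarrow> pt \<Rightarrow> real" where
  "fejer N h = trigpoly N (\<lambda>k. complex_of_real (fejer_weight N k) * fcoef h k)"

lemma finite_fejer_box [simp]: "finite (fejer_box N)"
  by (simp add: fejer_box_def)

lemma card_fejer_box: "card (fejer_box N) = (N div 2 + 1)^2"
  by (simp add: fejer_box_def card_cartesian_product power2_eq_square nat_add_distrib)

lemma fejer_weight_eq:
  "fejer_weight N k = real (card {l \<in> fejer_box N. l + k \<in> fejer_box N}) / real (card (fejer_box N))"
proof -
  have "bij_betw (\<lambda>l. (l + k, l)) {l \<in> fejer_box N. l + k \<in> fejer_box N} {p \<in> fejer_box N \<times> fejer_box N. fst p - snd p = k}"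
    by (rule bij_betw_byWitness[where f' = snd]) (auto simp: algebra_simps)
  then show ?thesis by (simp add: fejer_weight_def bij_betw_same_card)
qed

lemma fejer_weight_zero [simp]: "fejer_weight N 0 = 1"
  by (simp add: fejer_weight_eq card_fejer_box)

lemma fejer_weight_minus [simp]: "fejer_weight N (- k) = fejer_weight N k"
proof -
  have "bij_betw (\<lambda>p. (snd p, fst p)) {p \<in> fejer_box N \<times> fejer_box N. fst p - snd p = - k} {p \<in> fejer_box N \<times> fejer_box N. fst p - snd p = k}"
    by (rule bij_betw_byWitness[where f' = "\<lambda>p. (snd p, fst p)"]) (auto simp: algebra_simps)
  then show ?thesis by (simp add: fejer_weight_def bij_betw_same_card)
qed

lemma herm_fejer: "herm (\<lambda>k. complex_of_real (fejer_weight N k) * fcoef h k)"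
  using herm_fcoef[of h] by (simp add: herm_def del: split_paired_All)

lemma card_shift_out_le: "card {t \<in> {0..m::int}. t + k \<notin> {0..m}} \<le> nat \<bar>k\<bar>"
proof -
  have "{t \<in> {0..m}. t + k \<notin> {0..m}} \<subseteq> (if 0 \<le> k then {m - k + 1..m} else {0..- k - 1})"
    by auto
  then have "card {t \<in> {0..m}. t + k \<notin> {0..m}} \<le> card (if 0 \<le> k then {m - k + 1..m} else {0..- k - 1})"
    by (intro card_mono) auto
  also have "\<dots> = nat \<bar>k\<bar>" by auto
  finally show ?thesis .
qed

text \<open>By \<open>fejer_weight_eq\<close>, 1 - weight is the fraction of the box that the shift
  by k moves outside. The two coordinates lose at most |k_1| / M and |k_2| / M, where M = N div 2 +
  1 \<ge> N / 2.\<close>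

lemma fejer_weight_bounds:
  assumes "1 \<le> N"
  shows "fejer_weight N k \<le> 1" "(1 - fejer_weight N k)^2 \<le> 8 * ksq k / real N ^ 2"
proof -
  let ?B = "fejer_box N"
  define M where "M = real (N div 2 + 1)"
  have M: "1 \<le> M" "real N / 2 \<le> M" by (auto simp: M_def)
  have cB: "real (card ?B) = M^2" by (simp add: card_fejer_box M_def)
  have "card {l \<in> ?B. l + k \<in> ?B} \<le> card ?B" by (intro card_mono) auto
  then have "real (card {l \<in> ?B. l + k \<in> ?B}) \<le> M^2" using cB by linarith
  then show le1: "fejer_weight N k \<le> 1" using M by (simp add: fejer_weight_eq cB)
  let ?J = "{0..int (N div 2)}"
  have "card {l \<in> ?B. l + k \<notin> ?B} \<le> card ({t \<in> ?J. t + fst k \<notin> ?J} \<times> ?J \<union> ?J \<times> {t \<in> ?J. t + snd k \<notin> ?J})"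
  proof (rule card_mono)
    show "{l \<in> ?B. l + k \<notin> ?B} \<subseteq> {t \<in> ?J. t + fst k \<notin> ?J} \<times> ?J \<union> ?J \<times> {t \<in> ?J. t + snd k \<notin> ?J}"
      unfolding fejer_box_def by (cases k) auto
    show "finite ({t \<in> ?J. t + fst k \<notin> ?J} \<times> ?J \<union> ?J \<times> {t \<in> ?J. t + snd k \<notin> ?J})"
      by (intro finite_UnI finite_cartesian_product finite_Collect_conjI finite_atLeastAtMost_int) simp_all
  qed
  also have "\<dots> \<le> card ({t \<in> ?J. t + fst k \<notin> ?J} \<times> ?J) + card (?J \<times> {t \<in> ?J. t + snd k \<notin> ?J})"
    by (rule card_Un_le)
  also have "\<dots> \<le> nat \<bar>fst k\<bar> * card ?J + card ?J * nat \<bar>snd k\<bar>"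
    unfolding card_cartesian_product by (intro add_mono mult_le_mono card_shift_out_le order_refl)
  finally have "real (card {l \<in> ?B. l + k \<notin> ?B}) \<le> real (nat \<bar>fst k\<bar> * card ?J + card ?J * nat \<bar>snd k\<bar>)"
    by linarith
  also have "\<dots> = (\<bar>real_of_int (fst k)\<bar> + \<bar>real_of_int (snd k)\<bar>) * M"
    by (simp add: M_def nat_add_distrib algebra_simps)
  finally have out: "real (card {l \<in> ?B. l + k \<notin> ?B}) \<le> (\<bar>real_of_int (fst k)\<bar> + \<bar>real_of_int (snd k)\<bar>) * M" .
  have "card ?B = card ({l \<in> ?B. l + k \<in> ?B} \<union> {l \<in> ?B. l + k \<notin> ?B})" by (rule arg_cong[where f = card]) auto
  also have "\<dots> = card {l \<in> ?B. l + k \<in> ?B} + card {l \<in> ?B. l + k \<notin> ?B}" by (intro card_Un_disjoint) auto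
  finally have "real (card {l \<in> ?B. l + k \<in> ?B}) = M^2 - real (card {l \<in> ?B. l + k \<notin> ?B})"
    using cB by linarith
  then have "1 - fejer_weight N k = real (card {l \<in> ?B. l + k \<notin> ?B}) / M^2"
    using M by (simp add: fejer_weight_eq cB diff_divide_distrib)
  also have "\<dots> \<le> (\<bar>real_of_int (fst k)\<bar> + \<bar>real_of_int (snd k)\<bar>) * M / M^2"
    by (intro divide_right_mono out) auto
  also have "\<dots> = (\<bar>real_of_int (fst k)\<bar> + \<bar>real_of_int (snd k)\<bar>) / M" using M by (simp add: power2_eq_square)
  also have "\<dots> \<le> (\<bar>real_of_int (fst k)\<bar> + \<bar>real_of_int (snd k)\<bar>) / (real N / 2)"
    using M assms by (intro divide_left_mono) auto
  finally have "(1 - fejer_weight N k)^2 \<le> ((\<bar>real_of_int (fst k)\<bar> + \<bar>real_of_int (snd k)\<bar>) / (real N / 2))^2"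
    using le1 by (intro sq_le_of_abs_le) auto
  also have "\<dots> = 4 * (\<bar>real_of_int (fst k)\<bar> + \<bar>real_of_int (snd k)\<bar>)^2 / real N ^ 2"
    by (simp only: power_divide) simp
  also have "\<dots> \<le> 4 * (2 * (\<bar>real_of_int (fst k)\<bar>^2 + \<bar>real_of_int (snd k)\<bar>^2)) / real N ^ 2"
    by (intro divide_right_mono mult_left_mono sum_sq_le_2) auto
  also have "\<dots> = 8 * ksq k / real N ^ 2" by (simp add: ksq_def)
  finally show "(1 - fejer_weight N k)^2 \<le> 8 * ksq k / real N ^ 2" .
qed

lemma fejer_box_diff_mode:
  assumes "j \<in> fejer_box N" "l \<in> fejer_box N"
  shows "j - l \<in> modes N"
proof -
  let ?m = "int (N div 2)"
  have abs: "\<bar>fst (j - l)\<bar> \<le> ?m" "\<bar>snd (j - l)\<bar> \<le> ?m"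
    using assms by (auto simp: fejer_box_def mem_Times_iff)
  have "real_of_int \<bar>fst (j - l)\<bar> \<le> real N / 2" "real_of_int \<bar>snd (j - l)\<bar> \<le> real N / 2"
    using abs by linarith+
  then have "(real_of_int (fst (j - l)))^2 \<le> (real N / 2)^2" "(real_of_int (snd (j - l)))^2 \<le> (real N / 2)^2"
    by (intro sq_le_of_abs_le; simp)+
  then have "ksq (j - l) \<le> real N ^ 2 / 4 + real N ^ 2 / 4"
    unfolding ksq_def of_int_add of_int_power by (simp add: power_divide)
  also have "\<dots> \<le> real N ^ 2" by simp
  finally show ?thesis using abs by (auto simp: modes_def mem_Times_iff)
qed

text \<open>\<open>fejer N\<close> is convolution with a positive multiple of \<open>|\<Sum>\<^sub>j e\<^sup>i\<^sup>j\<^sup>\<cdot>\<^sup>x|\<^sup>2\<close>, \<open>j\<close> ranging over \<open>fejer_box N\<close>.\<close>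

lemma fejer_nonneg:
  assumes h: "set_integrable lebesgue box2 h" and pos: "AE y in lebesgue. y \<in> box2 \<longrightarrow> 0 \<le> h y"
  shows "0 \<le> fejer N h x"
proof -
  let ?B = "fejer_box N" and ?P = "fejer_box N \<times> fejer_box N"
  let ?I = "set_lebesgue_integral lebesgue box2"
  define c where "c = real (card ?B)"
  have c: "0 < c" by (simp add: c_def card_fejer_box)
  define K where "K y = (cmod (\<Sum>j\<in>?B. ek j x * cnj (ek j y)))^2" for y
  have K: "complex_of_real (K y) = (\<Sum>p\<in>?P. ek (fst p - snd p) x * cnj (ek (fst p - snd p) y))" for y
    unfolding K_def complex_norm_square
    by (simp add: sum_product sum.cartesian_product case_prod_unfold ek_diff mult_ac)
  have "complex_of_real (fejer N h x) = (\<Sum>k\<in>modes N. complex_of_real (fejer_weight N k) * fcoef h k * ek k x)"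
    unfolding fejer_def by (rule trigpoly_complex[OF herm_fejer])
  also have "\<dots> = (\<Sum>k\<in>modes N. \<Sum>p\<in>{p \<in> ?P. fst p - snd p = k}. fcoef h (fst p - snd p) * ek (fst p - snd p) x) / c"
    by (simp add: sum_divide_distrib fejer_weight_def c_def mult.assoc)
  \<comment> \<open>The pairs were grouped by their difference; ungrouping is legitimate because
    every difference is a mode.\<close>
  also have "\<dots> = (\<Sum>p\<in>?P. fcoef h (fst p - snd p) * ek (fst p - snd p) x) / c"
    by (subst sum.group) (auto simp del: diff_Pair intro!: fejer_box_diff_mode)
  also have "\<dots> = (\<Sum>p\<in>?P. ?I (\<lambda>y. ek (fst p - snd p) x * (complex_of_real (h y) * cnj (ek (fst p - snd p) y)))) / (4 * pi^2 * c)"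
    unfolding fcoef_ek sum_divide_distrib set_integral_mult_right by (intro sum.cong refl) simp
  also have "\<dots> = ?I (\<lambda>y. \<Sum>p\<in>?P. ek (fst p - snd p) x * (complex_of_real (h y) * cnj (ek (fst p - snd p) y))) / (4 * pi^2 * c)"
    by (subst set_integral_sum) (auto intro!: set_integrable_mult_right set_integrable_mult_cnj_ek h)
  also have "(\<lambda>y. \<Sum>p\<in>?P. ek (fst p - snd p) x * (complex_of_real (h y) * cnj (ek (fst p - snd p) y))) = (\<lambda>y. complex_of_real (h y * K y))"
    unfolding of_real_mult K by (auto simp: sum_distrib_left mult_ac)
  also have "?I \<dots> / (4 * pi^2 * c) = complex_of_real (?I (\<lambda>y. h y * K y) / (4 * pi^2 * c))"
    unfolding set_integral_complex_of_real by simp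
  finally have "fejer N h x = ?I (\<lambda>y. h y * K y) / (4 * pi^2 * c)"
    by (rule of_real_eq_iff[THEN iffD1])
  moreover have "0 \<le> ?I (\<lambda>y. h y * K y)"
    unfolding set_lebesgue_integral_def
  proof (rule integral_nonneg_AE)
    show "AE y in lebesgue. 0 \<le> indicat_real box2 y *\<^sub>R (h y * K y)"
      using pos by eventually_elim (auto simp: indicator_def K_def)
  qed
  ultimately show ?thesis using c by simp
qed

lemma fejer_add:
  assumes "set_integrable lebesgue box2 f" "set_integrable lebesgue box2 g"
  shows "fejer N (\<lambda>x. f x + g x) x = fejer N f x + fejer N g x"
  by (simp add: fejer_def fcoef_add[OF assms] distrib_left trigpoly_add)

lemma fejer_cmult: "fejer N (\<lambda>x. c * f x) x = c * fejer N f x"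
  by (simp add: fejer_def fcoef_cmult trigpoly_def sum_distrib_left algebra_simps)

lemma fejer_const: "fejer N (\<lambda>_. c) x = c"
proof -
  have "fejer N (\<lambda>_. c) x = Re (\<Sum>k\<in>modes N. if k = 0 then complex_of_real c else 0)"
    unfolding fejer_def trigpoly_def by (intro arg_cong[where f = Re] sum.cong) (auto simp: fcoef_const)
  then show ?thesis by simp
qed

lemma integral_fejer: "set_lebesgue_integral lebesgue box2 (fejer N h) = set_lebesgue_integral lebesgue box2 h"
proof -
  have "fcoef (fejer N h) 0 = fcoef h 0"
    unfolding fejer_def by (subst fcoef_trigpoly[OF herm_fejer]) simp
  then show ?thesis
    unfolding fcoef_zero of_real_eq_iff by simp
qed

lemma set_integrable_const_box2: "set_integrable lebesgue box2 (\<lambda>_. c :: real)"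
  by (rule set_integrable_box2_continuous) simp

text \<open>Positivity applied to C - u and C + u, with constants reproduced by
  \<open>fejer_const\<close>.\<close>

lemma fejer_abs_le:
  assumes "set_integrable lebesgue box2 u" "AE y in lebesgue. y \<in> box2 \<longrightarrow> \<bar>u y\<bar> \<le> C"
  shows "\<bar>fejer N u x\<bar> \<le> C"
proof -
  note ci = set_integrable_const_box2[of C]
  have "0 \<le> fejer N (\<lambda>y. C + (-1) * u y) x"
  proof (rule fejer_nonneg)
    show "set_integrable lebesgue box2 (\<lambda>y. C + (-1) * u y)"
      by (intro set_integral_add ci set_integrable_mult_right assms)
    show "AE y in lebesgue. y \<in> box2 \<longrightarrow> 0 \<le> C + (-1) * u y"
      using assms(2) by eventually_elim auto
  qed
  also have "fejer N (\<lambda>y. C + (-1) * u y) x = C + (-1) * fejer N u x"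
    by (subst fejer_add[OF ci set_integrable_mult_right]) (auto intro: assms simp only: fejer_const fejer_cmult)
  finally have "fejer N u x \<le> C" by simp
  have "0 \<le> fejer N (\<lambda>y. C + u y) x"
  proof (rule fejer_nonneg)
    show "set_integrable lebesgue box2 (\<lambda>y. C + u y)" by (intro set_integral_add ci assms)
    show "AE y in lebesgue. y \<in> box2 \<longrightarrow> 0 \<le> C + u y"
      using assms(2) by eventually_elim auto
  qed
  also have "fejer N (\<lambda>y. C + u y) x = C + fejer N u x"
    by (simp only: fejer_add[OF ci assms(1)] fejer_const)
  finally show ?thesis using \<open>fejer N u x \<le> C\<close> by simp
qed

text \<open>Positivity applied to (u - c)^2, where c is the value of the mean at the point x
  itself.\<close>

lemma fejer_jensen:
  assumes u: "set_integrable lebesgue box2 u" and u2: "set_integrable lebesgue box2 (\<lambda>x. (u x)^2)"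
  shows "(fejer N u x)^2 \<le> fejer N (\<lambda>y. (u y)^2) x"
proof -
  define c where "c = fejer N u x"
  have i: "set_integrable lebesgue box2 (\<lambda>y. (- 2 * c) * u y)" by (intro set_integrable_mult_right u)
  note i2 = set_integral_add(1)[OF u2 i]
  have "(u y - c)^2 = ((u y)^2 + (- 2 * c) * u y) + c^2" for y
    by (simp add: power2_eq_square algebra_simps)
  then have "0 \<le> fejer N (\<lambda>y. ((u y)^2 + (- 2 * c) * u y) + c^2) x"
    by (intro fejer_nonneg set_integral_add(1)[OF i2] set_integrable_const_box2) (metis (no_types, lifting) AE_I2 zero_le_power2)
  also have "\<dots> = (fejer N (\<lambda>y. (u y)^2) x + (- 2 * c) * fejer N u x) + c^2"
    by (simp only: fejer_add[OF i2 set_integrable_const_box2] fejer_add[OF u2 i] fejer_cmult fejer_const)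
  finally show ?thesis by (simp add: c_def power2_eq_square)
qed

lemma sum_ksq_fcoef_le_dirichlet:
  assumes "in_H1 u"
  shows "4 * pi^2 * (\<Sum>k\<in>modes N. ksq k * (cmod (fcoef u k))^2) \<le> dirichlet u"
proof -
  have "(\<Sum>k\<in>modes N. ksq k * (cmod (fcoef u k))^2) \<le> (\<Sum>\<^sub>\<infinity>k. ksq k * (cmod (fcoef u k))^2)"
    using assms unfolding in_H1_def by (intro finite_sum_le_infsum) auto
  then show ?thesis unfolding dirichlet_def by (intro mult_left_mono) auto
qed

text \<open>The disc multiplier is not uniformly bounded on \<open>L\<^sup>4\<close>; comparing it with the Fejer mean costs
  a term \<open>\<parallel>\<nabla>u\<parallel>\<^sup>4 / N\<^sup>2\<close>, whence the factor \<open>(\<nu>N)\<^sup>-\<^sup>2\<close> in the energy bound.\<close>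

lemma PiN_initial_bounds:
  assumes nu: "0 < \<nu>" and N: "1 \<le> N" and meas: "u \<in> borel_measurable lebesgue" and H1: "in_H1 u"
    and C: "AE x in lebesgue. x \<in> box2 \<longrightarrow> \<bar>u x\<bar> \<le> C" and E0: "E0 = CH_energy \<nu> u"
  shows "(PiN N u x)^2 \<le> 2 * C^2 + 144 * (E0 / \<nu>)"
    and "CH_energy \<nu> (PiN N u) \<le> 17 * E0 + 170 + 46080 * (E0 / (\<nu> * real N))^2"
proof -
  let ?I = "set_lebesgue_integral lebesgue box2"
  define w where "w = fejer_weight N"
  \<comment> \<open>The difference between the sharp truncation and the Fejer mean; its multiplier 1
    - w is of size |k| / N.\<close>
  define g where "g = trigpoly N (\<lambda>k. complex_of_real (1 - w k) * fcoef u k)"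
  have hg: "herm (\<lambda>k. complex_of_real (1 - w k) * fcoef u k)"
    using herm_fcoef[of u] by (simp add: herm_def w_def del: split_paired_All)
  have split: "PiN N u y = fejer N u y + g y" for y
    unfolding PiN_def fejer_def g_def w_def[symmetric] trigpoly_add[symmetric] by (simp add: algebra_simps)
  note int = set_integrable_box2_continuous
  have cf: "continuous_on UNIV (fejer N h)" for h by (simp add: fejer_def continuous_trigpoly)
  have cg: "continuous_on UNIV g" by (simp add: g_def continuous_trigpoly)
  have cP: "continuous_on UNIV (PiN N u)" by (simp add: PiN_def continuous_trigpoly)
  have pow_int: "set_integrable lebesgue box2 (\<lambda>x. (u x)^n)" for n
  proof (rule set_integrable_bounded)
    show "AE x in lebesgue. x \<in> box2 \<longrightarrow> \<bar>(u x)^n\<bar> \<le> C^n"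
      using C by eventually_elim (auto simp: power_abs intro!: power_mono)
  qed (use meas in measurable)
  have D: "(\<Sum>k\<in>modes N. ksq k * (cmod (fcoef u k))^2) \<le> E0 / \<nu>"
    unfolding E0 by (rule sum_ksq_fcoef_le_energy[OF nu sum_ksq_fcoef_le_dirichlet[OF H1]])
  have "0 \<le> (\<Sum>k\<in>modes N. ksq k * (cmod (fcoef u k))^2)" by (intro sum_nonneg) auto
  then have e: "0 \<le> E0 / \<nu>" using D by linarith
  have "(\<Sum>k\<in>modes N. (cmod (complex_of_real (1 - w k) * fcoef u k))^2)
      \<le> (\<Sum>k\<in>modes N. 8 / real N ^ 2 * (ksq k * (cmod (fcoef u k))^2))"
  proof (rule sum_mono)
    fix k
    have "(cmod (complex_of_real (1 - w k) * fcoef u k))^2 = (1 - w k)^2 * (cmod (fcoef u k))^2"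
      by (simp only: norm_mult norm_of_real power_mult_distrib power2_abs)
    also have "\<dots> \<le> 8 * ksq k / real N ^ 2 * (cmod (fcoef u k))^2"
      unfolding w_def by (intro mult_right_mono fejer_weight_bounds[OF N]) auto
    finally show "(cmod (complex_of_real (1 - w k) * fcoef u k))^2 \<le> 8 / real N ^ 2 * (ksq k * (cmod (fcoef u k))^2)"
      by simp
  qed
  also have "\<dots> \<le> 8 / real N ^ 2 * (E0 / \<nu>)"
    unfolding sum_distrib_left[symmetric] by (intro mult_left_mono D) auto
  finally have g2: "(\<Sum>k\<in>modes N. (cmod (complex_of_real (1 - w k) * fcoef u k))^2) \<le> 8 / real N ^ 2 * (E0 / \<nu>)" .
  \<comment> \<open>The N^2 of the mode count cancels the 1 / N^2 gained in \<open>g2\<close>; 72 =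
    9 * 8.\<close>
  have gsup: "(g y)^2 \<le> 72 * (E0 / \<nu>)" for y
  proof -
    have "(g y)^2 \<le> (\<Sum>k\<in>modes N. cmod (complex_of_real (1 - w k) * fcoef u k))^2"
      unfolding g_def by (rule sq_le_of_abs_le[OF abs_trigpoly_le])
    also have "\<dots> \<le> 9 * real N ^ 2 * (8 / real N ^ 2 * (E0 / \<nu>))"
      using sum_modes_sq_le[OF N] g2 by (rule order_trans[OF _ mult_left_mono]) auto
    finally show ?thesis using N by simp
  qed
  have "\<bar>fejer N u x\<bar> \<le> C" by (rule fejer_abs_le[OF _ C]) (use pow_int[of 1] in simp)
  then have "2 * ((fejer N u x)^2 + (g x)^2) \<le> 2 * (C^2 + 72 * (E0 / \<nu>))"
    by (intro mult_left_mono add_mono gsup sq_le_of_abs_le) auto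
  then show "(PiN N u x)^2 \<le> 2 * C^2 + 144 * (E0 / \<nu>)"
    unfolding split by (intro order_trans[OF sum_sq_le_2]) simp
  \<comment> \<open>One factor g^2 is estimated in the sup norm and the other in L^2, which keeps
    the gain 1 / N^2. Here 23040 = 72 * 40 * 8, with 40 above 4 pi^2.\<close>
  have gI4: "?I (\<lambda>y. (g y)^4) \<le> 23040 * (E0 / (\<nu> * real N))^2"
  proof -
    have "?I (\<lambda>y. (g y)^4) \<le> ?I (\<lambda>y. 72 * (E0 / \<nu>) * (g y)^2)"
    proof (rule set_integral_mono_continuous)
      fix y
      have "(g y)^4 = (g y)^2 * (g y)^2" by (simp flip: power_add)
      also have "\<dots> \<le> 72 * (E0 / \<nu>) * (g y)^2" by (intro mult_right_mono gsup) auto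
      finally show "(g y)^4 \<le> 72 * (E0 / \<nu>) * (g y)^2" .
    qed (intro continuous_intros cg)+
    also have "\<dots> = 72 * (E0 / \<nu>) * (4 * pi^2 * (\<Sum>k\<in>modes N. (cmod (complex_of_real (1 - w k) * fcoef u k))^2))"
      unfolding g_def integral_trigpoly_sq[OF hg, symmetric] by simp
    also have "\<dots> \<le> 72 * (E0 / \<nu>) * (40 * (8 / real N ^ 2 * (E0 / \<nu>)))"
      using pi_sq_bounds e by (intro mult_left_mono mult_mono g2) (auto intro!: sum_nonneg)
    also have "\<dots> = 23040 * (E0 / (\<nu> * real N))^2" by (simp add: power2_eq_square)
    finally show ?thesis .
  qed
  \<comment> \<open>Jensen twice bounds the fourth power of the mean by the mean of the fourth
    power, whose integral is that of u^4.\<close>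
  have uI4: "?I (\<lambda>y. (fejer N u y)^4) \<le> 8 * E0 + 80"
  proof -
    have jen: "(fejer N u y)^4 \<le> fejer N (\<lambda>z. (u z)^4) y" for y
    proof -
      have "0 \<le> (fejer N u y)^2" by simp
      moreover have "(fejer N u y)^2 \<le> fejer N (\<lambda>z. (u z)^2) y"
        using pow_int[of 1] by (intro fejer_jensen pow_int) simp
      ultimately have "((fejer N u y)^2)^2 \<le> (fejer N (\<lambda>z. (u z)^2) y)^2" by (intro power_mono)
      also have "\<dots> \<le> fejer N (\<lambda>z. ((u z)^2)^2) y"
        using pow_int[of 4] by (intro fejer_jensen pow_int) (simp flip: power_mult)
      finally show ?thesis by (simp flip: power_mult)
    qed
    have Fint: "set_integrable lebesgue box2 (\<lambda>x. Fdw (u x))"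
    proof -
      have "(\<lambda>x. Fdw (u x)) = (\<lambda>x. 1/4 * (u x)^4 + (- (1/2) * (u x)^2 + 1/4))"
        by (auto simp: Fdw_def power2_eq_square power4_eq_xxxx field_simps)
      then show ?thesis
        by (simp only:) (intro set_integral_add(1) set_integrable_mult_right pow_int set_integrable_const_box2)
    qed
    have "?I (\<lambda>y. (fejer N u y)^4) \<le> ?I (fejer N (\<lambda>z. (u z)^4))"
      by (rule set_integral_mono_continuous) (intro continuous_intros cf jen)+
    also have "\<dots> = ?I (\<lambda>z. (u z)^4)" by (rule integral_fejer)
    also have "\<dots> \<le> ?I (\<lambda>z. 8 * Fdw (u z) + 2)"
      by (intro set_integral_mono pow_int set_integral_add(1) set_integrable_mult_right Fint set_integrable_const_box2 pow4_le_Fdw)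
    also have "\<dots> = ?I (\<lambda>z. 8 * Fdw (u z)) + ?I (\<lambda>_. 2)"
      by (intro set_integral_add(2) set_integrable_mult_right Fint set_integrable_const_box2)
    also have "\<dots> = 8 * ?I (\<lambda>z. Fdw (u z)) + 8 * pi^2" by (simp add: set_integral_const_box2)
    also have "\<dots> \<le> 8 * E0 + 80"
      using integral_Fdw_le_energy[of \<nu> u] nu pi_sq_bounds by (simp add: E0)
    finally show ?thesis .
  qed
  \<comment> \<open>Uses F(s) \<le> (s^4 + 1) / 4 and (a + b)^4 \<le> 8 (a^4 + b^4).\<close>
  have "?I (\<lambda>y. Fdw (PiN N u y)) \<le> ?I (\<lambda>y. 2 * (fejer N u y)^4 + (2 * (g y)^4 + 1/4))"
  proof (rule set_integral_mono_continuous)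
    fix y
    have "(PiN N u y)^4 = ((fejer N u y + g y)^2)^2" by (simp add: split flip: power_mult)
    also have "\<dots> \<le> (2 * ((fejer N u y)^2 + (g y)^2))^2" by (intro power_mono sum_sq_le_2) auto
    also have "\<dots> \<le> 4 * (2 * (((fejer N u y)^2)^2 + ((g y)^2)^2))"
      unfolding power_mult_distrib using sum_sq_le_2[of "(fejer N u y)^2" "(g y)^2"] by simp
    finally show "Fdw (PiN N u y) \<le> 2 * (fejer N u y)^4 + (2 * (g y)^4 + 1/4)"
      using Fdw_le_pow4[of "PiN N u y"] by (simp flip: power_mult)
  qed (intro continuous_intros continuous_Fdw cP cf cg)+
  also have "\<dots> = ?I (\<lambda>y. 2 * (fejer N u y)^4) + ?I (\<lambda>y. 2 * (g y)^4 + 1/4)"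
    by (intro set_integral_add(2) int continuous_intros cf cg)
  also have "\<dots> = ?I (\<lambda>y. 2 * (fejer N u y)^4) + (?I (\<lambda>y. 2 * (g y)^4) + ?I (\<lambda>_. 1/4))"
    by (intro arg_cong2[where f = "(+)"] refl set_integral_add(2) int continuous_intros cf cg)
  also have "\<dots> = 2 * ?I (\<lambda>y. (fejer N u y)^4) + (2 * ?I (\<lambda>y. (g y)^4) + pi^2)"
    by (simp add: set_integral_const_box2)
  also have "\<dots> \<le> 2 * (8 * E0 + 80) + (2 * (23040 * (E0 / (\<nu> * real N))^2) + 10)"
    using pi_sq_bounds by (intro add_mono mult_left_mono uI4 gI4) auto
  finally have "?I (\<lambda>y. Fdw (PiN N u y)) \<le> 16 * E0 + 170 + 46080 * (E0 / (\<nu> * real N))^2" by simp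
  moreover have "\<nu> / 2 * dirichlet (PiN N u) \<le> E0"
  proof -
    have "dirichlet (PiN N u) \<le> dirichlet u"
      unfolding PiN_def dirichlet_trigpoly[OF herm_fcoef] by (rule sum_ksq_fcoef_le_dirichlet[OF H1])
    then have "\<nu> * dirichlet (PiN N u) \<le> \<nu> * dirichlet u" using nu by (intro mult_left_mono) auto
    then show ?thesis using dirichlet_le_energy[OF nu, of u] by (simp add: E0)
  qed
  ultimately show "CH_energy \<nu> (PiN N u) \<le> 17 * E0 + 170 + 46080 * (E0 / (\<nu> * real N))^2"
    by (simp add: CH_energy_def)
qed

section \<open>Propagation of the bounds\<close>

text \<open>With H = \<nu> G and l = |ln \<nu>|, the logarithm is at most 2 sqrt H + 3 + l^2, while
  H \<ge> \<beta> (l^2 + \<nu>). Everything is then at most a multiple of H / sqrt \<beta>, and a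
  large \<beta> beats C.\<close>

lemma ln_sq_absorbs_log:
  fixes C \<nu> \<beta> G :: real
  assumes C: "0 \<le> C" and nu: "0 < \<nu>" and \<beta>: "1 + (21 * C)^2 \<le> \<beta>" and G: "\<beta> * (\<bar>ln \<nu>\<bar>^2 / \<nu> + 1) \<le> G"
  shows "C * (1 + ln (1 + G / \<nu>)) \<le> \<nu> * G"
proof -
  define l where "l = \<bar>ln \<nu>\<bar>"
  define H where "H = \<nu> * G"
  have \<beta>1: "1 \<le> \<beta>" using \<beta> zero_le_power2[of "21 * C"] by linarith
  have "\<nu> * (\<beta> * (l^2 / \<nu> + 1)) \<le> H"
    unfolding H_def l_def using G nu by (intro mult_left_mono) auto
  moreover have "\<nu> * (\<beta> * (l^2 / \<nu> + 1)) = \<beta> * (l^2 + \<nu>)" using nu by (simp add: field_simps)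
  ultimately have H: "\<beta> * (l^2 + \<nu>) \<le> H" by simp
  \<comment> \<open>Small \<nu> forces a large logarithm, so H has a lower bound independent of
    \<nu>.\<close>
  have "1 / 4 \<le> l^2 + \<nu>"
  proof (cases "1 / 4 \<le> \<nu>")
    case True
    then show ?thesis by (simp add: add_increasing)
  next
    case False
    then have "3 / 4 \<le> l" using ln_le_minus_one[OF nu] by (simp add: l_def)
    then have "(3 / 4)^2 \<le> l^2" by (intro power_mono) auto
    then show ?thesis using nu by (simp add: power_divide)
  qed
  then have "\<beta> * (1 / 4) \<le> \<beta> * (l^2 + \<nu>)" using \<beta>1 by (intro mult_left_mono) auto
  with H have H4: "\<beta> / 4 \<le> H" by simp
  then have H0: "0 < H" using \<beta>1 by linarith
  have "\<beta> * l^2 \<le> \<beta> * (l^2 + \<nu>)" using nu \<beta>1 by (intro mult_left_mono) auto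
  then have "\<beta> * l^2 \<le> H" using H by (rule order_trans)
  then have l2: "l^2 \<le> H / \<beta>" using \<beta>1 by (simp add: pos_le_divide_eq mult.commute)
  define r where "r = sqrt H"
  have r: "0 < r" "r^2 = H" using H0 by (auto simp: r_def)
  have "ln (1 + H) \<le> ln ((1 + r)^2)" using r H0 by (subst ln_le_cancel_iff) (auto simp: power2_sum)
  also have "\<dots> = 2 * ln (1 + r)" using r by (simp add: ln_realpow)
  also have "\<dots> \<le> 2 * r" using r ln_add_one_self_le_self[of r] by simp
  finally have lnH: "ln (1 + H) \<le> 2 * r" .
  have ln\<nu>: "ln (1 + 1 / \<nu>) \<le> 1 + l"
  proof (cases "1 \<le> \<nu>")
    case True
    have "ln (1 + 1 / \<nu>) \<le> 1 / \<nu>" using nu by (intro ln_add_one_self_le_self) auto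
    also have "\<dots> \<le> 1" using True by simp
    finally show ?thesis by (simp add: l_def)
  next
    case False
    have "ln (1 + 1 / \<nu>) \<le> ln (2 / \<nu>)" using nu False by (subst ln_le_cancel_iff) (auto simp: field_simps add_pos_pos)
    also have "\<dots> = ln 2 - ln \<nu>" using nu by (simp add: ln_div)
    also have "\<dots> \<le> 1 + l" using ln_le_minus_one[of 2] by (simp add: l_def)
    finally show ?thesis .
  qed
  \<comment> \<open>Since G / \<nu> = H / \<nu>^2, the logarithm splits into a part in H and a part
    in \<nu>.\<close>
  have "1 + G / \<nu> \<le> (1 + H) * (1 + 1 / \<nu>)^2"
  proof -
    have "G / \<nu> = H * (1 / \<nu>)^2" using nu by (simp add: H_def power2_eq_square)
    also have "\<dots> \<le> H * (1 + 1 / \<nu>)^2" using nu H0 by (intro mult_left_mono power_mono) auto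
    finally have "G / \<nu> \<le> H * (1 + 1 / \<nu>)^2" .
    moreover have "1 \<le> (1 + 1 / \<nu>)^2" using nu by (intro one_le_power) simp
    ultimately have "1 + G / \<nu> \<le> (1 + 1 / \<nu>)^2 + H * (1 + 1 / \<nu>)^2" by (intro add_mono)
    then show ?thesis by (simp only: distrib_right mult_1_left)
  qed
  moreover have "0 < G" using H0 nu by (simp add: H_def zero_less_mult_iff)
  moreover have "0 < 1 + 1 / \<nu>" using nu by (simp add: add_pos_pos)
  ultimately have "ln (1 + G / \<nu>) \<le> ln ((1 + H) * (1 + 1 / \<nu>)^2)"
    using nu by (intro ln_mono add_pos_pos) auto
  also have "\<dots> = ln (1 + H) + 2 * ln (1 + 1 / \<nu>)"
    using H0 \<open>0 < 1 + 1 / \<nu>\<close> by (subst ln_mult_pos) (auto simp: ln_realpow)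
  also have "\<dots> \<le> 2 * r + (3 + l^2)"
    using lnH ln\<nu> zero_le_power2[of "l - 1"] by (simp add: power2_diff)
  finally have "1 + ln (1 + G / \<nu>) \<le> 4 + 2 * r + H / \<beta>" using l2 by linarith
  define b where "b = sqrt \<beta>"
  have b: "1 \<le> b" "b^2 = \<beta>" using \<beta>1 by (auto simp: b_def)
  have br: "b \<le> 2 * r" 
  proof (rule power2_le_imp_le)
    show "b^2 \<le> (2 * r)^2" using H4 by (simp add: power_mult_distrib r b)
  qed (use r in simp)
  \<comment> \<open>After multiplication by b the three terms are at most 16 H, 4 H and H, using b
    \<le> 4 H, b \<le> 2 r and b \<ge> 1.\<close>
  have "4 + 2 * r + H / \<beta> \<le> 21 * H / b"
  proof -
    have "1 \<le> 2 * r" using b br by linarith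
    have "b * 1 \<le> (2 * r) * (2 * r)" using b br \<open>1 \<le> 2 * r\<close> by (intro mult_mono) auto
    then have "4 * b \<le> 16 * H" using r by (simp add: power2_eq_square)
    moreover have "r * b \<le> r * (2 * r)" using br r by (intro mult_left_mono) auto
    then have "2 * r * b \<le> 4 * r^2" unfolding power2_eq_square by linarith
    then have "2 * r * b \<le> 4 * H" by (simp only: r)
    moreover have "H / \<beta> * b \<le> H"
    proof -
      have "H / \<beta> * b = H / b" using b by (simp add: b(2)[symmetric] power2_eq_square)
      also have "\<dots> \<le> H / 1" using b H0 by (intro divide_left_mono) auto
      finally show ?thesis by simp
    qed
    ultimately have "4 * b + 2 * r * b + H / \<beta> * b \<le> 16 * H + 4 * H + H" by (intro add_mono)
    then have "(4 + 2 * r + H / \<beta>) * b \<le> 21 * H" by (simp add: distrib_right del: times_divide_eq_left)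
    then show ?thesis using b by (simp add: pos_le_divide_eq)
  qed
  with \<open>1 + ln (1 + G / \<nu>) \<le> 4 + 2 * r + H / \<beta>\<close> have "C * (1 + ln (1 + G / \<nu>)) \<le> C * (21 * H / b)"
    using C by (intro mult_left_mono) auto
  also have "\<dots> = (21 * C) / b * H" by simp
  also have "\<dots> \<le> 1 * H"
  proof (rule mult_right_mono)
    have "21 * C \<le> b" unfolding b_def using \<beta> by (intro real_le_rsqrt) auto
    then show "21 * C / b \<le> 1" using b by simp
  qed (use H0 in simp)
  finally show ?thesis by (simp add: H_def)
qed

lemma CH_step_energy_le_sq:
  assumes "0 < \<nu>" "0 < \<tau>" "0 \<le> A" "PiN N u = u"
    and S: "\<And>x. (u x)^2 \<le> S" "\<And>x. (CH_step \<nu> \<tau> A N u x)^2 \<le> S"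
    and G: "3 * S / 2 \<le> A + sqrt (\<nu> / \<tau>)"
  shows "CH_energy \<nu> (CH_step \<nu> \<tau> A N u) \<le> CH_energy \<nu> u"
proof (rule CH_step_energy_le[OF assms(1-4), where M = "sqrt S"])
  have "0 \<le> S" using order_trans[OF zero_le_power2 S(1)] .
  then show "3 * (sqrt S)^2 / 2 \<le> A + sqrt (\<nu> / \<tau>)" using G by simp
qed (use S in \<open>auto intro!: real_le_rsqrt\<close>)

lemma CH_energy_nonneg: "0 \<le> \<nu> \<Longrightarrow> 0 \<le> CH_energy \<nu> u"
  unfolding CH_energy_def by (intro add_nonneg_nonneg mult_nonneg_nonneg dirichlet_nonneg set_integral_nonneg_box2) auto

section \<open>Stability of one step in the two regimes\<close>

text \<open>With K the assumed energy bound, N^2 K = 2 C / \<nu>^2 is independent of N, so Nikolskii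
  bounds u^2, and \<open>CH_step_diff_sup_le\<close> the squared increment, by multiples of 1 /
  \<nu>. The energy bound alone suffices to restart the argument at each step.\<close>

lemma CH_step_stable_coarse:
  assumes pos: "0 < \<nu>" "0 < \<tau>" "0 < A" and N: "1 \<le> N" "\<nu> * real N \<le> 1" and C: "80 \<le> C"
    and A: "2106 * C^2 \<le> \<nu> * A"
    and u: "PiN N u = u" and E: "CH_energy \<nu> u \<le> 2 * C / (\<nu> * real N)^2"
  shows "CH_energy \<nu> (CH_step \<nu> \<tau> A N u) \<le> CH_energy \<nu> u"
proof -
  let ?I = "set_lebesgue_integral lebesgue box2"
  define K where "K = 2 * C / (\<nu> * real N)^2"
  define n where "n = real N"
  have n: "1 \<le> n" "\<nu> * n \<le> 1" using N by (auto simp: n_def)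
  have nK: "n^2 * K = 2 * C / \<nu>^2" using n pos by (simp add: K_def n_def[symmetric] power_mult_distrib)
  have "(\<nu> * n)^2 \<le> 1" using n pos by (intro power_le_one) auto
  then have "2 * C / 1 \<le> K" unfolding K_def n_def[symmetric] using C n pos by (intro divide_left_mono) auto
  then have K: "80 \<le> K" using C by simp
  have E': "CH_energy \<nu> u \<le> K" using E by (simp add: K_def)
  have cu: "continuous_on UNIV u" by (rule continuous_PiN_fixed[OF u])
  have "?I (\<lambda>x. (u x)^4) \<le> ?I (\<lambda>x. 8 * Fdw (u x) + 2)"
    by (rule set_integral_mono_continuous) (intro continuous_intros continuous_Fdw cu pow4_le_Fdw)+
  also have "\<dots> = ?I (\<lambda>x. 8 * Fdw (u x)) + ?I (\<lambda>_. 2)"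
    by (intro set_integral_add(2) set_integrable_box2_continuous continuous_intros continuous_Fdw cu)
  also have "\<dots> = 8 * ?I (\<lambda>x. Fdw (u x)) + 8 * pi^2" by (simp add: set_integral_const_box2)
  also have "\<dots> \<le> 9 * K"
    using integral_Fdw_le_energy[of \<nu> u] pos E' pi_sq_bounds K by simp
  finally have I4: "?I (\<lambda>x. (u x)^4) \<le> 9 * K" .
  define S where "S = 18 * C / \<nu>"
  have S: "(u x)^2 \<le> S" for x
  proof (rule power2_le_imp_le)
    have "((u x)^2)^2 = (u x)^4" by (simp flip: power_mult)
    also have "\<dots> \<le> n^2 * ?I (\<lambda>x. (u x)^4)" unfolding n_def by (rule nikolskii_4[OF u N(1)])
    also have "\<dots> \<le> n^2 * (9 * K)" by (intro mult_left_mono I4) auto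
    also have "\<dots> = 18 * C / \<nu>^2" using nK by simp
    \<comment> \<open>As 18 C \<ge> 1, squaring it avoids a square root in S.\<close>
    also have "\<dots> \<le> (18 * C)^2 / \<nu>^2"
      using C by (intro divide_right_mono) (auto simp: power2_eq_square)
    finally show "((u x)^2)^2 \<le> S^2" by (simp add: S_def power_divide)
  qed (use C pos in \<open>simp add: S_def\<close>)
  have P: "(\<Sum>k\<in>modes N. ksq k * (cmod (fcoef u k))^2) \<le> K / \<nu>"
    using sum_ksq_fcoef_le_energy[OF pos(1) eq_refl[OF dirichlet_PiN_fixed[OF u, symmetric]]] E' pos by (meson divide_right_mono less_imp_le order_trans)
  have S0: "0 \<le> S" using C pos by (simp add: S_def)
  have Q: "(\<Sum>k\<in>modes N. (cmod (fcoef (\<lambda>x. fdw (u x)) k))^2) \<le> S * K"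
    by (rule order_trans[OF sum_fcoef_fdw_le_energy[OF pos(1) u S]]) (intro mult_left_mono E' S0)
  have CC: "C \<le> C^2" using C by (simp add: power2_eq_square)
  have w: "(CH_step \<nu> \<tau> A N u x - u x)^2 \<le> 684 * C^2 / \<nu>" for x
  proof -
    have "\<nu>^2 * n^4 * (K / \<nu>) + n^2 * (S * K) = (\<nu> * n^2 + S) * (n^2 * K)"
      using pos by (simp add: power2_eq_square power4_eq_xxxx algebra_simps)
    also have "\<dots> \<le> (19 * C / \<nu>) * (n^2 * K)"
    proof (rule mult_right_mono)
      have "(\<nu> * n)^2 \<le> C" using \<open>(\<nu> * n)^2 \<le> 1\<close> C by linarith
      then have "\<nu> * n^2 \<le> C / \<nu>" using pos by (simp add: pos_le_divide_eq power2_eq_square mult_ac)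
      then show "\<nu> * n^2 + S \<le> 19 * C / \<nu>" by (simp add: S_def)
    qed (use K in simp)
    also have "\<dots> = 38 * C^2 / \<nu>^3" unfolding nK by (simp add: power2_eq_square power3_eq_cube)
    finally have le: "\<nu>^2 * n^4 * (K / \<nu>) + n^2 * (S * K) \<le> 38 * C^2 / \<nu>^3" .
    have "(CH_step \<nu> \<tau> A N u x - u x)^2 \<le> 18 / A^2 * (\<nu>^2 * n^4 * (K / \<nu>) + n^2 * (S * K))"
      unfolding n_def by (rule CH_step_diff_sup_le[OF pos N(1) u P Q])
    also have "\<dots> \<le> 18 / A^2 * (38 * C^2 / \<nu>^3)"
      by (intro mult_left_mono le) auto
    also have "\<dots> = 684 * C^2 / \<nu> / (\<nu> * A)^2" by (simp add: power2_eq_square power3_eq_cube)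
    also have "\<dots> \<le> 684 * C^2 / \<nu> / 1"
    proof (intro divide_left_mono)
      have "1 \<le> \<nu> * A" using A CC C by linarith
      then show "1 \<le> (\<nu> * A)^2" by (rule one_le_power)
    qed (use pos in auto)
    finally show ?thesis by simp
  qed
  show ?thesis
  \<comment> \<open>The sup bound has 1404 = 2 * (18 + 684), and 2106 = 3/2 * 1404 is the constant
    required of A.\<close>
  proof (rule CH_step_energy_le_sq[OF pos(1,2) less_imp_le[OF pos(3)] u])
    show "(u x)^2 \<le> 1404 * C^2 / \<nu>" for x
    proof -
      have "S \<le> 1404 * C^2 / \<nu>" unfolding S_def using pos C CC by (intro divide_right_mono) auto
      then show ?thesis using S[of x] by linarith
    qed
    show "(CH_step \<nu> \<tau> A N u x)^2 \<le> 1404 * C^2 / \<nu>" for x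
    proof -
      have "(CH_step \<nu> \<tau> A N u x)^2 \<le> 2 * ((u x)^2 + (CH_step \<nu> \<tau> A N u x - u x)^2)"
        using sum_sq_le_2[of "u x" "CH_step \<nu> \<tau> A N u x - u x"] by simp
      also have "\<dots> \<le> 2 * (18 * C^2 / \<nu> + 684 * C^2 / \<nu>)"
      proof (intro mult_left_mono add_mono w)
        have "S \<le> 18 * C^2 / \<nu>" unfolding S_def using pos C CC by (intro divide_right_mono) auto
        then show "(u x)^2 \<le> 18 * C^2 / \<nu>" using S[of x] by linarith
      qed simp
      finally show ?thesis by simp
    qed
    have "0 \<le> sqrt (\<nu> / \<tau>)" using pos by simp
    moreover have "3 * (1404 * C^2 / \<nu>) / 2 \<le> A" using A pos by (simp add: pos_divide_le_eq mult.commute)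
    ultimately show "3 * (1404 * C^2 / \<nu>) / 2 \<le> A + sqrt (\<nu> / \<tau>)" by linarith
  qed
qed

text \<open>The sup bound 2/3 G reproduces itself: in the nonlinear term its factor G cancels
  against L = G / \<nu>, and the linear term is absorbed by \<open>CG\<close>. The constant
  satisfies 96 + 128 = 2/3 * 336.\<close>

lemma CH_step_stable_fine:
  assumes pos: "0 < \<nu>" "0 < \<tau>" "0 < A" and C: "0 \<le> C" and G: "G = A + sqrt (\<nu> / \<tau>)"
    and CG: "336 * C * (1 + ln (1 + G / \<nu>)) \<le> \<nu> * G"
    and u: "PiN N u = u" "fcoef u 0 = 0" and E: "CH_energy \<nu> u \<le> 2 * C" and S: "\<And>x. (u x)^2 \<le> 2 / 3 * G"
  shows "(CH_step \<nu> \<tau> A N u x)^2 \<le> 2 / 3 * G"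
    and "CH_energy \<nu> (CH_step \<nu> \<tau> A N u) \<le> CH_energy \<nu> u"
proof -
  have "0 < sqrt (\<nu> / \<tau>)" using pos by simp
  then have G0: "0 < G" unfolding G using pos by (intro add_pos_pos)
  define l where "l = 1 + ln (1 + G / \<nu>)"
  have l: "1 \<le> l" using G0 pos by (simp add: l_def)
  have P: "(\<Sum>k\<in>modes N. ksq k * (cmod (fcoef u k))^2) \<le> 2 * C / \<nu>"
    using sum_ksq_fcoef_le_energy[OF pos(1) eq_refl[OF dirichlet_PiN_fixed[OF u(1), symmetric]]] E pos by (meson divide_right_mono less_imp_le order_trans)
  have Q: "(\<Sum>k\<in>modes N. (cmod (fcoef (\<lambda>x. fdw (u x)) k))^2) \<le> 2 / 3 * G * (2 * C)"
    by (rule order_trans[OF sum_fcoef_fdw_le_energy[OF pos(1) u(1) S]]) (intro mult_left_mono E, use G0 in simp)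
  have sup: "(CH_step \<nu> \<tau> A N u x)^2 \<le> 2 / 3 * G" for x
  proof -
    have "(CH_step \<nu> \<tau> A N u x)^2 \<le> 48 * l * (2 * C / \<nu>) + 96 / (\<nu>^2 * (G / \<nu>)) * (2 / 3 * G * (2 * C))"
      unfolding l_def by (rule CH_step_sup_le[OF pos _ u(2) P Q]) (simp add: G)
    also have "96 / (\<nu>^2 * (G / \<nu>)) * (2 / 3 * G * (2 * C)) = 128 * C / \<nu> * 1"
      using G0 pos by (simp add: power2_eq_square)
    also have "\<dots> \<le> 128 * C / \<nu> * l"
      using l C pos by (intro mult_left_mono) auto
    also have "48 * l * (2 * C / \<nu>) + 128 * C / \<nu> * l = 2 / 3 * (336 * C * l / \<nu>)" by simp
    also have "\<dots> \<le> 2 / 3 * G"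
      using CG pos by (intro mult_left_mono) (auto simp: l_def pos_divide_le_eq mult.commute)
    finally show ?thesis by simp
  qed
  then show "(CH_step \<nu> \<tau> A N u x)^2 \<le> 2 / 3 * G" .
  show "CH_energy \<nu> (CH_step \<nu> \<tau> A N u) \<le> CH_energy \<nu> u"
    by (rule CH_step_energy_le_sq[OF pos(1,2) less_imp_le[OF pos(3)] u(1) S sup]) (simp add: G)
qed

text \<open>The added 1 makes it unnecessary that the infimum be attained; it is paid for by the
  summand 1 in the condition on A.\<close>

lemma ess_bounded_AE_Linf:
  assumes "ess_bounded u"
  shows "0 \<le> Linf_norm u" "AE x in lebesgue. x \<in> box2 \<longrightarrow> \<bar>u x\<bar> \<le> Linf_norm u + 1"
proof -
  let ?S = "{C. 0 \<le> C \<and> (AE x in lebesgue. x \<in> box2 \<longrightarrow> \<bar>u x\<bar> \<le> C)}"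
  obtain C where "AE x in lebesgue. x \<in> box2 \<longrightarrow> \<bar>u x\<bar> \<le> C" using assms by (auto simp: ess_bounded_def)
  then have "AE x in lebesgue. x \<in> box2 \<longrightarrow> \<bar>u x\<bar> \<le> \<bar>C\<bar>" by eventually_elim auto
  then have ne: "?S \<noteq> {}" by (auto intro!: exI[of _ "\<bar>C\<bar>"])
  then show "0 \<le> Linf_norm u" unfolding Linf_norm_def by (intro cInf_greatest) auto
  obtain D where "D \<in> ?S" "D < Linf_norm u + 1"
    using cInf_lessD[OF ne, of "Linf_norm u + 1"] by (auto simp: Linf_norm_def)
  then have "AE x in lebesgue. x \<in> box2 \<longrightarrow> \<bar>u x\<bar> \<le> D" "D < Linf_norm u + 1" by auto
  then show "AE x in lebesgue. x \<in> box2 \<longrightarrow> \<bar>u x\<bar> \<le> Linf_norm u + 1"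
    by (auto elim!: eventually_mono)
qed

section \<open>Induction over the time steps\<close>

text \<open>C collects the constants of the initial energy bound. In \<beta>, the 12 serves the
  initial sup bound, and the square feeds \<open>ln_sq_absorbs_log\<close> with the constant 2106
  C^2, which covers both regimes.\<close>

lemma CH_seq_energy_decreasing:
  assumes pos: "0 < \<nu>" "0 < \<tau>" and N: "1 \<le> N" and meas: "u0 \<in> borel_measurable lebesgue"
    and bd: "ess_bounded u0" and H1: "in_H1 u0" and mean: "set_lebesgue_integral lebesgue box2 u0 = 0"
    and E0: "E0 = CH_energy \<nu> u0" and C: "C = 17 * \<bar>E0\<bar> + 170 + 46080 * E0^2"
    and \<beta>: "12 + (21 * (2106 * C^2))^2 \<le> \<beta>"
    and A: "\<beta> * ((Linf_norm u0)^2 + \<bar>ln \<nu>\<bar>^2 / \<nu> + 1) \<le> A"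
  shows "CH_energy \<nu> (CH_seq \<nu> \<tau> A N u0 (Suc n)) \<le> CH_energy \<nu> (CH_seq \<nu> \<tau> A N u0 n)"
proof -
  let ?u = "CH_seq \<nu> \<tau> A N u0"
  define G where "G = A + sqrt (\<nu> / \<tau>)"
  have E0': "0 \<le> E0" unfolding E0 using pos by (intro CH_energy_nonneg) auto
  have C1: "170 \<le> C" "17 * E0 \<le> C" using E0' by (auto simp: C)
  have CC: "170 * C \<le> C^2" unfolding power2_eq_square using C1 by (intro mult_right_mono) auto
  have \<beta>': "12 \<le> \<beta>" "1 + (21 * (2106 * C^2))^2 \<le> \<beta>" using \<beta> zero_le_power2[of "21 * (2106 * C^2)"] by linarith+
  have lnpos: "0 \<le> \<bar>ln \<nu>\<bar>^2 / \<nu>" using pos by simp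
  have AG: "A \<le> G" using pos by (simp add: G_def)
  have A1: "\<beta> * (\<bar>ln \<nu>\<bar>^2 / \<nu> + 1) \<le> A"
    by (rule order_trans[OF _ A]) (use \<beta>' in \<open>intro mult_left_mono, auto\<close>)
  have "\<beta> * 1 \<le> \<beta> * (\<bar>ln \<nu>\<bar>^2 / \<nu> + 1)" using lnpos \<beta>' by (intro mult_left_mono) auto
  with A1 \<beta>' have A0: "0 < A" by linarith
  have absorb: "2106 * C^2 * (1 + ln (1 + g / \<nu>)) \<le> \<nu> * g" if "A \<le> g" for g
    by (rule ln_sq_absorbs_log[OF _ pos(1) \<beta>'(2)]) (use A1 that in auto)
  have absorb1: "2106 * C^2 \<le> \<nu> * g" if "A \<le> g" for g
  proof -
    have "2106 * C^2 * 1 \<le> 2106 * C^2 * (1 + ln (1 + g / \<nu>))"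
      using that A0 pos by (intro mult_left_mono) auto
    then show ?thesis using absorb[OF that] by linarith
  qed
  note bounds = PiN_initial_bounds[OF pos(1) N meas H1 ess_bounded_AE_Linf(2)[OF bd] E0]
  have E1: "CH_energy \<nu> (?u 0) \<le> C * (1 + 1 / (\<nu> * real N)^2)"
  proof -
    have "CH_energy \<nu> (?u 0) \<le> 17 * E0 + 170 + 46080 * (E0 / (\<nu> * real N))^2" using bounds(2) by simp
    also have "\<dots> = (17 * E0 + 170) + (46080 * E0^2) / (\<nu> * real N)^2" by (simp add: power_divide)
    also have "\<dots> \<le> C + C / (\<nu> * real N)^2"
      using E0' by (intro add_mono divide_right_mono) (auto simp: C)
    finally show ?thesis by (simp add: distrib_left)
  qed
  have nN: "0 < \<nu> * real N" using pos N by simp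
  show ?thesis
  proof (cases "\<nu> * real N \<le> 1")
    case True
    then have "(\<nu> * real N)^2 \<le> 1" using nN by (intro power_le_one) auto
    moreover have "0 < (\<nu> * real N)^2" using nN by (rule zero_less_power)
    ultimately have "1 \<le> 1 / (\<nu> * real N)^2" by (simp only: le_divide_eq_1_pos)
    then have "C * (1 + 1 / (\<nu> * real N)^2) \<le> C * (1 / (\<nu> * real N)^2 + 1 / (\<nu> * real N)^2)"
      using C1 by (intro mult_left_mono) auto
    with E1 have base: "CH_energy \<nu> (?u 0) \<le> 2 * C / (\<nu> * real N)^2" by simp
    have step: "CH_energy \<nu> (?u (Suc m)) \<le> CH_energy \<nu> (?u m)" if "CH_energy \<nu> (?u m) \<le> 2 * C / (\<nu> * real N)^2" for m
      unfolding CH_seq.simps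
      by (rule CH_step_stable_coarse[OF pos A0 N True _ absorb1[OF order_refl] PiN_CH_seq that]) (use C1 in simp)
    have "CH_energy \<nu> (?u m) \<le> 2 * C / (\<nu> * real N)^2" for m
      by (induction m) (use base step in \<open>force simp del: CH_seq.simps\<close>)+
    then show ?thesis by (rule step)
  next
    case False
    then have "1 \<le> (\<nu> * real N)^2" by (intro one_le_power) auto
    then have "1 / (\<nu> * real N)^2 \<le> 1 / 1" using N by (intro divide_left_mono) auto
    then have "C * (1 + 1 / (\<nu> * real N)^2) \<le> C * (1 + 1)"
      using C1 by (intro mult_left_mono) auto
    then have base: "CH_energy \<nu> (?u 0) \<le> 2 * C" using order_trans[OF E1] by simp
    \<comment> \<open>The parts 4 (?L^2 + 1) and 144 E0 / \<nu> of the initial bound are each at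
      most G / 3.\<close>
    have base': "(?u 0 x)^2 \<le> 2 / 3 * G" for x
    proof -
      let ?L = "Linf_norm u0"
      have "(?L + 1)^2 \<le> 2 * (?L^2 + 1^2)" by (rule sum_sq_le_2)
      moreover have "12 * (?L^2 + 1) \<le> A"
      proof -
        have "12 * (?L^2 + 1) \<le> \<beta> * (?L^2 + \<bar>ln \<nu>\<bar>^2 / \<nu> + 1)"
          using \<beta>' lnpos by (intro mult_mono) auto
        then show ?thesis using A by linarith
      qed
      moreover have "432 * (E0 / \<nu>) \<le> G"
      proof -
        have "432 * E0 \<le> \<nu> * G" using absorb1[OF AG] CC C1 by linarith
        then show ?thesis using pos by (simp add: pos_divide_le_eq mult.commute)
      qed
      ultimately show ?thesis using bounds(1)[of x] AG by simp
    qed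
    have CG: "336 * C * (1 + ln (1 + G / \<nu>)) \<le> \<nu> * G"
    proof -
      have "336 * C * (1 + ln (1 + G / \<nu>)) \<le> 2106 * C^2 * (1 + ln (1 + G / \<nu>))"
        using CC C1 A0 AG pos by (intro mult_right_mono) auto
      then show ?thesis using absorb[OF AG] by linarith
    qed
    note step = CH_step_stable_fine[OF pos A0 _ G_def CG PiN_CH_seq fcoef_CH_seq_zero[OF mean]]
    \<comment> \<open>Both bounds travel together: the next sup bound uses the current energy bound,
      and energy decay uses the sup bounds at both times.\<close>
    have "CH_energy \<nu> (?u m) \<le> 2 * C \<and> (\<forall>x. (?u m x)^2 \<le> 2 / 3 * G)" for m
    proof (induction m)
      case 0
      show ?case using base base' by blast
    next
      case (Suc m)
      then have E: "CH_energy \<nu> (?u m) \<le> 2 * C" and S: "\<And>x. (?u m x)^2 \<le> 2 / 3 * G" by auto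
      have "CH_energy \<nu> (?u (Suc m)) \<le> CH_energy \<nu> (?u m)"
        unfolding CH_seq.simps by (rule step(2)[OF _ E S]) (use C1 in simp)
      moreover have "(?u (Suc m) x)^2 \<le> 2 / 3 * G" for x
        unfolding CH_seq.simps by (rule step(1)[OF _ E S]) (use C1 in simp)
      ultimately show ?case using E by (auto intro: order_trans)
    qed
    then show ?thesis unfolding CH_seq.simps using C1 by (intro step(2)) auto
  qed
qed

theorem theorem1p1:
  shows "\<forall>E0::real. \<exists>\<beta>c>0. \<forall>(\<nu>::real) (\<tau>::real) (N::nat) (u0::pt \<Rightarrow> real) (A::real) (\<beta>::real).
    \<nu> > 0 \<and> \<tau> > 0 \<and> N \<ge> 2 \<and>
    periodic2 u0 \<and> u0 \<in> borel_measurable lebesgue \<and> ess_bounded u0 \<and> in_H1 u0 \<and>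
    set_lebesgue_integral lebesgue box2 u0 = 0 \<and>
    CH_energy \<nu> u0 = E0 \<and>
    \<beta> \<ge> \<beta>c \<and> A \<ge> \<beta> * ((Linf_norm u0)^2 + (\<bar>ln \<nu>\<bar>)^2 / \<nu> + 1)
    \<longrightarrow> (\<forall>n. CH_energy \<nu> (CH_seq \<nu> \<tau> A N u0 (Suc n)) \<le> CH_energy \<nu> (CH_seq \<nu> \<tau> A N u0 n))"
proof
  fix E0 :: real
  \<comment> \<open>E0 ranges over all reals here; the absolute value keeps C at least 170. C and
    \<beta>c are fixed before \<nu>, \<tau>, N and the datum.\<close>
  define C where "C = 17 * \<bar>E0\<bar> + 170 + 46080 * E0^2"
  define \<beta>c where "\<beta>c = 12 + (21 * (2106 * C^2))^2"
  have "0 < \<beta>c" by (simp add: \<beta>c_def add_pos_nonneg)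
  moreover have "CH_energy \<nu> (CH_seq \<nu> \<tau> A N u0 (Suc n)) \<le> CH_energy \<nu> (CH_seq \<nu> \<tau> A N u0 n)"
    if "\<nu> > 0 \<and> \<tau> > 0 \<and> N \<ge> 2 \<and>
      periodic2 u0 \<and> u0 \<in> borel_measurable lebesgue \<and> ess_bounded u0 \<and> in_H1 u0 \<and>
      set_lebesgue_integral lebesgue box2 u0 = 0 \<and> CH_energy \<nu> u0 = E0 \<and>
      \<beta> \<ge> \<beta>c \<and> A \<ge> \<beta> * ((Linf_norm u0)^2 + (\<bar>ln \<nu>\<bar>)^2 / \<nu> + 1)"
    for \<nu> \<tau> N u0 A \<beta> n
    using that by (intro CH_seq_energy_decreasing[OF _ _ _ _ _ _ _ _ C_def, where \<beta> = \<beta>]) (auto simp: \<beta>c_def simp del: CH_seq.simps)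
  ultimately show "\<exists>\<beta>c>0. \<forall>(\<nu>::real) (\<tau>::real) (N::nat) (u0::pt \<Rightarrow> real) (A::real) (\<beta>::real).
    \<nu> > 0 \<and> \<tau> > 0 \<and> N \<ge> 2 \<and>
    periodic2 u0 \<and> u0 \<in> borel_measurable lebesgue \<and> ess_bounded u0 \<and> in_H1 u0 \<and>
    set_lebesgue_integral lebesgue box2 u0 = 0 \<and>
    CH_energy \<nu> u0 = E0 \<and>
    \<beta> \<ge> \<beta>c \<and> A \<ge> \<beta> * ((Linf_norm u0)^2 + (\<bar>ln \<nu>\<bar>)^2 / \<nu> + 1)
    \<longrightarrow> (\<forall>n. CH_energy \<nu> (CH_seq \<nu> \<tau> A N u0 (Suc n)) \<le> CH_energy \<nu> (CH_seq \<nu> \<tau> A N u0 n))"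
    by blast
qed

end
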